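(* Every infinite discrete Abelian group $\Gamma$ contains a subset $E$ that is a Rosenthal set but is not a $\Lambda(p)$-set for any $p>0$.
   Context: Let $G=\widehat\Gamma$ be the compact dual group of $\Gamma$ (with normalized Haar measure), so that $\Gamma=\widehat G$. For $E\subseteq\Gamma$, $L^\infty_E(G)$ and $C_E(G)$ denote the functions in $L^\infty(G)$, respectively $C(G)$, whose Fourier transform vanishes off $E$. $E$ is a Rosenthal set if every essentially bounded function on $G$ with Fourier transform supported on $E$ is equal almost everywhere to a continuous function, i.e. $L^\infty_E(G)=C_E(G)$. For $p>0$, $E$ is a $\Lambda(p)$-set if there are $0<q<p$ and $C>0$ such that $\|P\|_p\le C\|P\|_q$ for every trigonometric polynomial $P$ on $G$ supported on $E$ (finite linear combination of characters in $E$), where $\|P\|_r=(\int_G|P|^r)^{1/r}$. *)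

theory Defs
  imports "HOL-Probability.Probability"
begin

text \<open>A discrete Abelian group \<open>\<Gamma>\<close> is a type \<open>'a\<close> of class \<open>ab_group_add\<close>.  Its compact
  dual \<open>G\<close> is a set of functions \<open>'a \<Rightarrow> complex\<close>, with pointwise multiplication and with the
  topology induced by the product topology on that function type.  An element \<open>\<gamma>\<close> of \<open>\<Gamma>\<close>
  is identified with the character \<open>\<xi> \<mapsto> \<xi> \<gamma>\<close> of \<open>G\<close>.\<close>

definition dual_group :: "('a::ab_group_add \<Rightarrow> complex) set" where
  "dual_group = {\<xi>. (\<forall>\<gamma>. norm (\<xi> \<gamma>) = 1) \<and> (\<forall>\<gamma> \<delta>. \<xi> (\<gamma> + \<delta>) = \<xi> \<gamma> * \<xi> \<delta>)}"

text \<open>The group may be non-metrizable (when \<open>\<Gamma>\<close> is uncountable), so regularity has to be required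
  of the translation-invariant Borel probability measure.\<close>

definition normalized_haar :: "('a::ab_group_add \<Rightarrow> complex) measure \<Rightarrow> bool" where
  "normalized_haar \<mu> \<longleftrightarrow>
     sets \<mu> = sets (restrict_space borel dual_group) \<and>
     prob_space \<mu> \<and>
     (\<forall>\<xi>\<in>dual_group. distr \<mu> \<mu> (\<lambda>\<psi> \<gamma>. \<xi> \<gamma> * \<psi> \<gamma>) = \<mu>) \<and>
     (\<forall>A\<in>sets \<mu>. emeasure \<mu> A = (SUP K\<in>{K. K \<subseteq> A \<and> compact K}. emeasure \<mu> K))"

definition fourier ::
  "('a::ab_group_add \<Rightarrow> complex) measure \<Rightarrow> (('a \<Rightarrow> complex) \<Rightarrow> complex) \<Rightarrow> 'a \<Rightarrow> complex" where
  "fourier \<mu> f \<gamma> = (LINT \<xi>|\<mu>. f \<xi> * cnj (\<xi> \<gamma>))"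

definition L_infinity ::
  "('a::ab_group_add \<Rightarrow> complex) measure \<Rightarrow> 'a set \<Rightarrow> (('a \<Rightarrow> complex) \<Rightarrow> complex) set" where
  "L_infinity \<mu> E = {f. f \<in> borel_measurable \<mu> \<and> (\<exists>B. AE \<xi> in \<mu>. norm (f \<xi>) \<le> B) \<and>
     (\<forall>\<gamma>. \<gamma> \<notin> E \<longrightarrow> fourier \<mu> f \<gamma> = 0)}"

definition C_space ::
  "('a::ab_group_add \<Rightarrow> complex) measure \<Rightarrow> 'a set \<Rightarrow> (('a \<Rightarrow> complex) \<Rightarrow> complex) set" where
  "C_space \<mu> E = {f. continuous_on dual_group f \<and> (\<forall>\<gamma>. \<gamma> \<notin> E \<longrightarrow> fourier \<mu> f \<gamma> = 0)}"

text \<open>Elements of \<open>L_infinity\<close> are functions rather than classes of functions, so the equality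
  of the two spaces is equality modulo null sets; only one inclusion is non-trivial.\<close>

definition rosenthal_set :: "('a::ab_group_add \<Rightarrow> complex) measure \<Rightarrow> 'a set \<Rightarrow> bool" where
  "rosenthal_set \<mu> E \<longleftrightarrow> (\<forall>f\<in>L_infinity \<mu> E. \<exists>g\<in>C_space \<mu> E. AE \<xi> in \<mu>. f \<xi> = g \<xi>)"

definition trig_polys :: "'a::ab_group_add set \<Rightarrow> (('a \<Rightarrow> complex) \<Rightarrow> complex) set" where
  "trig_polys E = {\<lambda>\<xi>. \<Sum>\<gamma>\<in>F. c \<gamma> * \<xi> \<gamma> | F c. finite F \<and> F \<subseteq> E}"

definition Lr_norm ::
  "('a::ab_group_add \<Rightarrow> complex) measure \<Rightarrow> real \<Rightarrow> (('a \<Rightarrow> complex) \<Rightarrow> complex) \<Rightarrow> real" where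
  "Lr_norm \<mu> r P = (LINT \<xi>|\<mu>. norm (P \<xi>) powr r) powr (1 / r)"

definition Lambda_set :: "('a::ab_group_add \<Rightarrow> complex) measure \<Rightarrow> real \<Rightarrow> 'a set \<Rightarrow> bool" where
  "Lambda_set \<mu> p E \<longleftrightarrow>
     (\<exists>q C. 0 < q \<and> q < p \<and> 0 < C \<and> (\<forall>P\<in>trig_polys E. Lr_norm \<mu> p P \<le> C * Lr_norm \<mu> q P))"

end

theory Submission
  imports Defs
begin

text \<open>The set is \<open>E = \<Union>\<^sub>n (\<theta>\<^sub>n + C\<^sub>n)\<close> with finite blocks \<open>C\<^sub>n\<close> containing all sums of at most \<open>n\<close> elements
  of a set \<open>A\<^sub>n\<close> that has small doubling and more than \<open>n\<close> elements. Blocks are finite subgroups if \<open>\<Gamma>\<close> has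
  infinite \<open>N\<close>-torsion for some \<open>N > 0\<close>, and arithmetic progressions \<open>j \<mapsto> j\<gamma>\<close> otherwise.

  For the Rosenthal property, choose finite \<open>B\<^sub>n\<close> that are almost invariant under \<open>C\<^sub>n\<close>, signs \<open>u\<^sub>n\<close> and points
  \<open>x\<^sub>n\<close> of the dual. The product of the nonnegative functions
  \<open>|\<Sum>\<^sub>b \<xi>(b) x\<^sub>n(b)\<^sup>-\<^sup>1|\<^sup>2 / |B\<^sub>n| (1 + u\<^sub>n Re \<xi>(\<theta>\<^sub>n))\<close>, \<open>b \<in> B\<^sub>n\<close>, is a kernel of Riesz type: if the blocks are far enough apart it has
  integral \<open>1\<close>, and its integral against a bounded \<open>f\<close> with spectrum in \<open>E\<close> is, up to small errors, a signed sum
  of the values at \<open>x\<^sub>n\<close> of the pieces \<open>Q\<^sub>n\<close> of the Fourier series of \<open>f\<close> on \<open>\<theta>\<^sub>n + C\<^sub>n\<close>. As signs and points are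
  arbitrary, \<open>\<Sum>\<^sub>n \<parallel>Q\<^sub>n\<parallel>\<^sub>\<infinity>\<close> is finite, so the blocked Fourier series converges uniformly, and \<open>f\<close> is
  continuous up to a null set.

  For \<open>\<Lambda>(p)\<close>, consider \<open>P = \<theta>\<^sub>n D\<^sup>k\<close> with \<open>D = \<Sum>\<^sub>\<gamma>\<^sub>\<in>\<^sub>A\<^sub>n \<gamma>\<close> and \<open>a = |A\<^sub>n|\<close>. Small doubling gives
  \<open>\<integral>|D|\<^sup>4 \<ge> a\<^sup>3/2\<close>, which with \<open>\<integral>|D|\<^sup>2 = a\<close> and \<open>|D| \<le> a\<close> makes the \<open>s\<close>-th moment of \<open>|D|\<close> comparable to
  \<open>a\<^sup>s\<^sup>-\<^sup>1\<close> for \<open>s \<ge> 2\<close>. For \<open>k \<ge> 2/q\<close> the ratio \<open>\<parallel>P\<parallel>\<^sub>p / \<parallel>P\<parallel>\<^sub>q\<close> therefore grows like \<open>a\<close> to the power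
  \<open>1/q - 1/p\<close>.\<close>

section \<open>Characters separate points\<close>

primrec nmul :: "nat \<Rightarrow> 'a::monoid_add \<Rightarrow> 'a" where
  "nmul 0 x = 0"
| "nmul (Suc n) x = x + nmul n x"

lemma nmul_add: "nmul (m + n) x = nmul m x + nmul n (x::'a::monoid_add)"
  by (induction m) (simp_all add: add.assoc)

lemma nmul_mult: "nmul (m * n) x = nmul m (nmul n (x::'a::monoid_add))"
  by (induction m) (simp_all add: nmul_add)

lemma nmul_zero [simp]: "nmul n (0::'a::monoid_add) = 0"
  by (induction n) simp_all

lemma nmul_diff: "nmul n (x - y) = nmul n x - nmul n (y::'a::ab_group_add)"
  by (induction n) (simp_all add: algebra_simps)

lemma nmul_diff_left: "n \<le> m \<Longrightarrow> nmul (m - n) x = nmul m x - nmul n (x::'a::ab_group_add)"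
  using nmul_add[of "m - n" n x] by simp

text \<open>A partial character is represented by its graph, a subgroup of \<open>\<Gamma> \<times> \<complex>\<^sup>\<times>\<close>.\<close>

definition partial_character :: "('a::ab_group_add \<times> complex) set \<Rightarrow> bool" where
  "partial_character R \<longleftrightarrow> (0, 1) \<in> R \<and> (\<forall>x a. (x, a) \<in> R \<longrightarrow> norm a = 1 \<and> (- x, inverse a) \<in> R)
     \<and> (\<forall>x a y b. (x, a) \<in> R \<longrightarrow> (y, b) \<in> R \<longrightarrow> (x + y, a * b) \<in> R) \<and> (\<forall>a. (0, a) \<in> R \<longrightarrow> a = 1)"

lemma partial_characterD:
  assumes "partial_character R"
  shows "(0, 1) \<in> R" "(x, a) \<in> R \<Longrightarrow> norm a = 1" "(x, a) \<in> R \<Longrightarrow> (- x, inverse a) \<in> R"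
    "(x, a) \<in> R \<Longrightarrow> (y, b) \<in> R \<Longrightarrow> (x + y, a * b) \<in> R" "(0, a) \<in> R \<Longrightarrow> a = 1"
  using assms unfolding partial_character_def by blast+

lemma partial_character_unique:
  assumes R: "partial_character R" and "(x, a) \<in> R" "(x, b) \<in> R"
  shows "a = b"
proof -
  have "(x + - x, a * inverse b) \<in> R"
    using assms partial_characterD(3,4)[OF R] by blast
  then have "a * inverse b = 1"
    using partial_characterD(5)[OF R] by simp
  moreover have "b \<noteq> 0"
    using partial_characterD(2)[OF R assms(3)] by auto
  ultimately show ?thesis by (simp add: field_simps)
qed

lemma partial_character_nmul:
  assumes R: "partial_character R" and "(x, a) \<in> R"
  shows "(nmul n x, a ^ n) \<in> R"
  using assms(2) partial_characterD(1,4)[OF R] by (induction n) auto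

text \<open>The new domain is generated by the old one and \<open>x\<close>. By \<open>comp\<close>
  the value \<open>z\<close> agrees with \<open>R\<close> on every multiple of \<open>x\<close> that
  already lies in the domain, which is what keeps the value at \<open>0\<close> equal to
  \<open>1\<close>.\<close>

lemma partial_character_extend:
  assumes R: "partial_character R" and z: "norm z = 1"
    and comp: "\<And>n b. (nmul n x, b) \<in> R \<Longrightarrow> b = z ^ n"
  shows "\<exists>R'. partial_character R' \<and> R \<subseteq> R' \<and> (x, z) \<in> R'"
proof -
  \<comment> \<open>Integer multiples of \<open>x\<close> are written as differences of two natural
    multiples.\<close>
  define R' where "R' = {(h + nmul j x - nmul k x, a * z ^ j / z ^ k) | h a j k. (h, a) \<in> R}"
  have z0: "z \<noteq> 0" using z by auto
  have R'I: "(h, a) \<in> R \<Longrightarrow> y = h + nmul j x - nmul k x \<Longrightarrow> c = a * z ^ j / z ^ k \<Longrightarrow> (y, c) \<in> R'"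
    for h a j k y c
    unfolding R'_def by blast
  have sub: "R \<subseteq> R'"
  proof
    fix p assume "p \<in> R"
    then show "p \<in> R'" using R'I[of "fst p" "snd p" "fst p" 0 0 "snd p"] by simp
  qed
  have "(x, z) \<in> R'"
    by (rule R'I[OF partial_characterD(1)[OF R], of _ 1 0]) simp_all
  moreover have "partial_character R'"
    unfolding partial_character_def
  proof (intro conjI allI impI)
    show "(0, 1) \<in> R'" using sub partial_characterD(1)[OF R] by blast
  next
    fix y c assume "(y, c) \<in> R'"
    then obtain h a j k where *: "(h, a) \<in> R" "y = h + nmul j x - nmul k x" "c = a * z ^ j / z ^ k"
      unfolding R'_def by blast
    show "norm c = 1"
      using z partial_characterD(2)[OF R *(1)] by (simp add: *(3) norm_mult norm_divide norm_power)
    show "(- y, inverse c) \<in> R'"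
      by (rule R'I[OF partial_characterD(3)[OF R *(1)], of _ k j])
        (simp_all add: * field_simps)
  next
    fix y c y' c' assume "(y, c) \<in> R'" "(y', c') \<in> R'"
    then obtain h a j k h' a' j' k' where *: "(h, a) \<in> R" "y = h + nmul j x - nmul k x" "c = a * z ^ j / z ^ k"
      and **: "(h', a') \<in> R" "y' = h' + nmul j' x - nmul k' x" "c' = a' * z ^ j' / z ^ k'"
      unfolding R'_def by blast
    show "(y + y', c * c') \<in> R'"
      by (rule R'I[OF partial_characterD(4)[OF R *(1) **(1)], of _ "j + j'" "k + k'"])
        (simp_all add: *(2,3) **(2,3) nmul_add power_add algebra_simps)
  next
    fix c assume "(0, c) \<in> R'"
    then obtain h a j k where *: "(h, a) \<in> R" "0 = h + nmul j x - nmul k x" "c = a * z ^ j / z ^ k"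
      unfolding R'_def by blast
    have a0: "a \<noteq> 0" using partial_characterD(2)[OF R *(1)] by auto
    show "c = 1"
    proof (cases "k \<le> j")
      case True
      then have "nmul (j - k) x = - h"
        using *(2) by (simp add: nmul_diff_left algebra_simps eq_neg_iff_add_eq_0)
      then have "inverse a = z ^ (j - k)"
        using comp partial_characterD(3)[OF R *(1)] by metis
      then have "inverse a = z ^ j / z ^ k" using True z0 by (simp add: power_diff)
      then show ?thesis
        using a0 by (simp add: *(3) field_simps)
    next
      case False
      then have "nmul (k - j) x = h"
        using *(2) by (simp add: nmul_diff_left algebra_simps)
      then have "a = z ^ (k - j)"
        using comp *(1) by metis
      then have "a = z ^ k / z ^ j" using False z0 by (simp add: power_diff)
      then show ?thesis
        using z0 by (simp add: *(3) field_simps)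
    qed
  qed
  ultimately show ?thesis using sub by blast
qed

text \<open>The circle is divisible: \<open>z\<close> is an \<open>m\<close>-th root of the value at
  \<open>nmul m x\<close>, where \<open>m\<close> is the least positive number with
  \<open>nmul m x\<close> in the domain. If there is none, any number of modulus one would do, and
  \<open>1\<close> is taken.\<close>

lemma partial_character_extend_point:
  assumes R: "partial_character R"
  shows "\<exists>R' z. partial_character R' \<and> R \<subseteq> R' \<and> (x, z) \<in> R'"
proof -
  have "\<exists>z. norm z = 1 \<and> (\<forall>n b. (nmul n x, b) \<in> R \<longrightarrow> b = z ^ n)"
  proof (cases "\<exists>n. n > 0 \<and> (\<exists>b. (nmul n x, b) \<in> R)")
    case False
    then have "n = 0" if "(nmul n x, b) \<in> R" for n b
      using that False gr0I by blast
    then have "b = 1" if "(nmul n x, b) \<in> R" for n b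
      using that partial_characterD(5)[OF R] by fastforce
    then show ?thesis by (intro exI[of _ 1]) auto
  next
    case True
    define m where "m = (LEAST n. n > 0 \<and> (\<exists>b. (nmul n x, b) \<in> R))"
    obtain b where m: "m > 0" "(nmul m x, b) \<in> R"
      using LeastI_ex[OF True] unfolding m_def by blast
    have least: "m \<le> n" if "n > 0" "(nmul n x, b) \<in> R" for n b
      unfolding m_def using that by (blast intro: Least_le)
    obtain z where z: "z ^ m = b"
      using exists_complex_root[of m b] m(1) by auto
    have nb: "norm b = 1" using partial_characterD(2)[OF R m(2)] .
    then have "norm z ^ m = 1" using z by (simp flip: norm_power)
    then have nz: "norm z = 1"
      using m(1) power_eq_imp_eq_base[of "norm z" m 1] by simp
    have "c = z ^ n" if c: "(nmul n x, c) \<in> R" for n c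
    proof -
      \<comment> \<open>Division with remainder: minimality of \<open>m\<close> forces
        \<open>r = 0\<close>, so only multiples of \<open>m\<close> lead into the domain.\<close>
      define q r where "q = n div m" and "r = n mod m"
      have n: "n = q * m + r" by (simp add: q_def r_def)
      have "(nmul (q * m) x, b ^ q) \<in> R"
        using partial_character_nmul[OF R m(2), of q] by (simp add: nmul_mult)
      then have "(nmul n x + - nmul (q * m) x, c * inverse (b ^ q)) \<in> R"
        using c partial_characterD(3,4)[OF R] by blast
      moreover have "nmul n x + - nmul (q * m) x = nmul r x"
        by (simp add: n nmul_add)
      ultimately have *: "(nmul r x, c * inverse (b ^ q)) \<in> R" by simp
      have "r < m" using m(1) by (simp add: r_def)
      then have "r = 0" using least[OF _ *] by force
      then have "c * inverse (b ^ q) = 1"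
        using * partial_characterD(5)[OF R] by simp
      moreover have "b \<noteq> 0" using nb by auto
      ultimately have "c = b ^ q" by (simp add: field_simps)
      then show ?thesis
        using \<open>r = 0\<close> unfolding n z[symmetric] by (simp add: mult.commute[of q] power_mult)
    qed
    then show ?thesis using nz by blast
  qed
  then obtain z where "norm z = 1" "\<And>n b. (nmul n x, b) \<in> R \<Longrightarrow> b = z ^ n" by blast
  then show ?thesis
    using partial_character_extend[OF R, of z x] by blast
qed

text \<open>Zorn's lemma on the graphs containing \<open>R0\<close>, ordered by inclusion. A maximal
  graph is total because \<open>partial_character_extend_point\<close> could otherwise enlarge
  it.\<close>

lemma partial_character_extend_total:
  fixes R0 :: "('a::ab_group_add \<times> complex) set"
  assumes R0: "partial_character R0"
  shows "\<exists>\<xi>\<in>dual_group. \<forall>(x, a)\<in>R0. \<xi> x = a"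
proof -
  let ?A = "{R. partial_character R \<and> R0 \<subseteq> R}"
  have "\<exists>M\<in>?A. \<forall>X\<in>?A. M \<subseteq> X \<longrightarrow> X = M"
  proof (rule subset_Zorn_nonempty)
    show "?A \<noteq> {}" using R0 by blast
    fix C assume C: "C \<noteq> {}" "subset.chain ?A C"
    have mem: "partial_character X" "R0 \<subseteq> X" if "X \<in> C" for X
      using C(2) that unfolding subset_chain_def by auto
    have dir: "X \<subseteq> Y \<or> Y \<subseteq> X" if "X \<in> C" "Y \<in> C" for X Y
      using C(2) that unfolding subset_chain_def by auto
    have "partial_character (\<Union>C)"
      unfolding partial_character_def
    proof (intro conjI allI impI)
      show "(0, 1) \<in> \<Union>C" using C(1) mem(1) partial_characterD(1) by blast
    next
      fix x a assume "(x, a) \<in> \<Union>C"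
      then show "norm a = 1" "(- x, inverse a) \<in> \<Union>C"
        using mem(1) partial_characterD(2,3) by blast+
    next
      fix x a y b assume "(x, a) \<in> \<Union>C" "(y, b) \<in> \<Union>C"
      then obtain X where "X \<in> C" "(x, a) \<in> X" "(y, b) \<in> X"
        using dir by blast
      then show "(x + y, a * b) \<in> \<Union>C"
        using mem(1) partial_characterD(4) by blast
    next
      fix a assume "(0, a) \<in> \<Union>C"
      then show "a = 1" using mem(1) partial_characterD(5) by blast
    qed
    then show "\<Union>C \<in> ?A" using C(1) mem(2) by blast
  qed
  then obtain M where M: "partial_character M" "R0 \<subseteq> M"
    and max: "\<And>X. partial_character X \<Longrightarrow> M \<subseteq> X \<Longrightarrow> X = M"
    by (smt (verit) mem_Collect_eq subset_trans)
  have "\<exists>z. (x, z) \<in> M" for x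
    using partial_character_extend_point[OF M(1), of x] max by metis
  then obtain \<xi> where \<xi>: "\<And>x. (x, \<xi> x) \<in> M" by metis
  have val: "\<xi> x = a" if "(x, a) \<in> M" for x a
    using partial_character_unique[OF M(1) \<xi> that] .
  have "\<xi> \<in> dual_group"
    unfolding dual_group_def using \<xi> partial_characterD(2,4)[OF M(1)] val by blast
  then show ?thesis using val M(2) by blast
qed

text \<open>The trivial character on \<open>{0}\<close> is extended to \<open>\<gamma>\<close> with
  a value \<open>z\<close> other than \<open>1\<close>: \<open>- 1\<close> if
  \<open>\<gamma>\<close> has infinite order, and a nontrivial \<open>m\<close>-th root of unity if
  it has order \<open>m\<close>.\<close>

lemma dual_group_separates:
  fixes \<gamma> :: "'a::ab_group_add"
  assumes "\<gamma> \<noteq> 0"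
  shows "\<exists>\<xi>\<in>dual_group. \<xi> \<gamma> \<noteq> 1"
proof -
  have triv: "partial_character {(0::'a, 1)}"
    by (simp add: partial_character_def)
  have "\<exists>z::complex. norm z = 1 \<and> z \<noteq> 1 \<and> (\<forall>n. nmul n \<gamma> = 0 \<longrightarrow> z ^ n = 1)"
  proof (cases "\<exists>n>0. nmul n \<gamma> = 0")
    case False
    then have "n = 0" if "nmul n \<gamma> = 0" for n
      using that False gr0I by blast
    then have "(- 1 :: complex) ^ n = 1" if "nmul n \<gamma> = 0" for n
      using that by fastforce
    then show ?thesis by (intro exI[of _ "-1"]) auto
  next
    case True
    define m where "m = (LEAST n. n > 0 \<and> nmul n \<gamma> = 0)"
    have m: "m > 0" "nmul m \<gamma> = 0"
      using LeastI_ex[of "\<lambda>n. n > 0 \<and> nmul n \<gamma> = 0"] True unfolding m_def by auto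
    have least: "m \<le> n" if "n > 0" "nmul n \<gamma> = 0" for n
      unfolding m_def using that by (blast intro: Least_le)
    have "m \<noteq> 1" using m(2) assms by auto
    then have "card {z::complex. z ^ m = 1} > 1"
      using m(1) by (simp add: card_roots_unity_eq)
    then have "\<not> {z::complex. z ^ m = 1} \<subseteq> {1}"
      by (metis card.empty card.insert card_mono empty_iff finite.emptyI finite.insertI
          leD le_eq_less_or_eq One_nat_def)
    then obtain z :: complex where z: "z ^ m = 1" "z \<noteq> 1" by blast
    have "norm z ^ m = 1" using z by (simp flip: norm_power)
    then have "norm z = 1"
      using m(1) power_eq_imp_eq_base[of "norm z" m 1] by simp
    moreover have "z ^ n = 1" if "nmul n \<gamma> = 0" for n
    proof -
      have "nmul n \<gamma> = nmul (n mod m) \<gamma>"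
        using nmul_add[of "n div m * m" "n mod m" \<gamma>] by (simp add: nmul_mult m(2))
      then have "n mod m = 0"
        using that least[of "n mod m"] m(1) by (metis gr_zeroI leD mod_less_divisor)
      then have "m dvd n" by auto
      then show ?thesis using z(1) by (auto simp: dvd_def power_mult)
    qed
    ultimately show ?thesis using z(2) by blast
  qed
  then obtain z :: complex where z: "norm z = 1" "z \<noteq> 1" "\<And>n. nmul n \<gamma> = 0 \<Longrightarrow> z ^ n = 1"
    by blast
  obtain R where R: "partial_character R" "(\<gamma>, z) \<in> R"
    using partial_character_extend[OF triv z(1), of \<gamma>] z(3) by force
  then show ?thesis
    using partial_character_extend_total[OF R(1)] z(2) by fastforce
qed

section \<open>The dual group and its Haar measure\<close>

lemma open_vimage_coordinate:
  "open U \<Longrightarrow> open ((\<lambda>h. h x) -` (U :: 'b::topological_space set) :: ('a \<Rightarrow> 'b) set)"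
  by (rule open_vimage[OF _ continuous_on_product_coordinates])

text \<open>The aim is the \<open>t2_space\<close> instance, which makes compact subsets of the dual
  closed and hence Borel; the two weaker separation classes are its superclasses. Points are
  separated by a coordinate in which they differ.\<close>

instance "fun" :: (type, t0_space) t0_space
proof
  fix f g :: "'a \<Rightarrow> 'b" assume "f \<noteq> g"
  then obtain x where "f x \<noteq> g x" by (auto simp: fun_eq_iff)
  from t0_space_class.t0_space[OF this] obtain U where "open U" "\<not> (f x \<in> U \<longleftrightarrow> g x \<in> U)"
    by auto
  then show "\<exists>U. open U \<and> \<not> (f \<in> U \<longleftrightarrow> g \<in> U)"
    by (intro exI[of _ "(\<lambda>h. h x) -` U"] conjI open_vimage_coordinate) simp_all
qed

instance "fun" :: (type, t1_space) t1_space
proof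
  fix f g :: "'a \<Rightarrow> 'b" assume "f \<noteq> g"
  then obtain x where "f x \<noteq> g x" by (auto simp: fun_eq_iff)
  from t1_space_class.t1_space[OF this] obtain U where "open U" "f x \<in> U" "g x \<notin> U"
    by auto
  then show "\<exists>U. open U \<and> f \<in> U \<and> g \<notin> U"
    by (intro exI[of _ "(\<lambda>h. h x) -` U"] conjI open_vimage_coordinate) simp_all
qed

instance "fun" :: (type, t2_space) t2_space
proof
  fix f g :: "'a \<Rightarrow> 'b" assume "f \<noteq> g"
  then obtain x where "f x \<noteq> g x" by (auto simp: fun_eq_iff)
  from t2_space_class.hausdorff[OF this] obtain U V where UV: "open U" "open V" "f x \<in> U" "g x \<in> V" "U \<inter> V = {}"
    by auto
  then show "\<exists>U V. open U \<and> open V \<and> f \<in> U \<and> g \<in> V \<and> U \<inter> V = {}"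
    by (intro exI[of _ "(\<lambda>h. h x) -` U"] exI[of _ "(\<lambda>h. h x) -` V"] conjI open_vimage_coordinate) auto
qed

lemma dual_groupD:
  assumes "\<xi> \<in> dual_group"
  shows "norm (\<xi> \<gamma>) = 1" "\<xi> (\<gamma> + \<delta>) = \<xi> \<gamma> * \<xi> \<delta>" "\<xi> 0 = 1" "\<xi> (- \<gamma>) = cnj (\<xi> \<gamma>)"
    "\<xi> (\<gamma> - \<delta>) = \<xi> \<gamma> * cnj (\<xi> \<delta>)"
proof -
  show n: "norm (\<xi> \<gamma>) = 1" and a: "\<xi> (\<gamma> + \<delta>) = \<xi> \<gamma> * \<xi> \<delta>" for \<gamma> \<delta>
    using assms by (auto simp: dual_group_def)
  have "\<xi> 0 * \<xi> 0 = \<xi> 0" using a[of 0 0] by simp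
  moreover have "\<xi> 0 \<noteq> 0" using n[of 0] by auto
  ultimately show 0: "\<xi> 0 = 1" by simp
  show m: "\<xi> (- \<gamma>) = cnj (\<xi> \<gamma>)" for \<gamma>
  proof -
    have "\<xi> \<gamma> * \<xi> (- \<gamma>) = 1" using a[of \<gamma> "- \<gamma>"] 0 by simp
    moreover have "\<xi> \<gamma> * cnj (\<xi> \<gamma>) = 1"
      using complex_norm_square[of "\<xi> \<gamma>"] n[of \<gamma>] by simp
    ultimately have "\<xi> \<gamma> * \<xi> (- \<gamma>) = \<xi> \<gamma> * cnj (\<xi> \<gamma>)" by simp
    moreover have "\<xi> \<gamma> \<noteq> 0" using n[of \<gamma>] by auto
    ultimately show ?thesis by simp
  qed
  show "\<xi> (\<gamma> - \<delta>) = \<xi> \<gamma> * cnj (\<xi> \<delta>)"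
    using a[of \<gamma> "- \<delta>"] m[of \<delta>] by simp
qed

lemma one_in_dual_group: "(\<lambda>_. 1) \<in> dual_group"
  by (simp add: dual_group_def)

lemma dual_group_mult_closed: "\<xi> \<in> dual_group \<Longrightarrow> \<psi> \<in> dual_group \<Longrightarrow> (\<lambda>\<gamma>. \<xi> \<gamma> * \<psi> \<gamma>) \<in> dual_group"
  by (auto simp: dual_group_def norm_mult)

lemma continuous_on_eval: "continuous_on S (\<lambda>\<xi>. \<xi> \<gamma> :: 'b::topological_space)"
  by (rule continuous_on_subset[OF continuous_on_product_coordinates subset_UNIV])

text \<open>Tychonoff's theorem for a product of circles, cut down by the closed condition of being
  multiplicative.\<close>

lemma compact_dual_group: "compact (dual_group :: ('a::ab_group_add \<Rightarrow> complex) set)"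
proof -
  let ?S = "PiE UNIV (\<lambda>_. sphere 0 1) :: ('a \<Rightarrow> complex) set"
  let ?H = "{\<xi> :: 'a \<Rightarrow> complex. \<forall>\<gamma> \<delta>. \<xi> (\<gamma> + \<delta>) = \<xi> \<gamma> * \<xi> \<delta>}"
  have "compactin (product_topology (\<lambda>_::'a. euclidean) UNIV) ?S"
    unfolding compactin_PiE by simp
  then have "compact ?S"
    by (simp add: euclidean_product_topology)
  moreover have "closed ?H"
    by (intro closed_Collect_all closed_Collect_eq continuous_on_mult continuous_on_eval)
  ultimately have "compact (?S \<inter> ?H)" by (rule compact_Int_closed)
  moreover have "dual_group = ?S \<inter> ?H"
    by (auto simp: dual_group_def)
  ultimately show ?thesis by simp
qed

text \<open>Agreement is demanded on the dual only: a product of two evaluations is an evaluation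
  there, but not at arbitrary functions.\<close>

definition trig_poly_on_dual :: "'a::ab_group_add set \<Rightarrow> (('a \<Rightarrow> complex) \<Rightarrow> complex) \<Rightarrow> bool" where
  "trig_poly_on_dual S P \<longleftrightarrow> (\<exists>F c. finite F \<and> F \<subseteq> S \<and> (\<forall>\<xi>\<in>dual_group. P \<xi> = (\<Sum>\<gamma>\<in>F. c \<gamma> * \<xi> \<gamma>)))"

text \<open>The frequencies \<open>w i\<close> may coincide, so the coefficients are summed over the
  fibres of \<open>w\<close>.\<close>

lemma trig_poly_on_dual_family:
  fixes S :: "'a::ab_group_add set"
  assumes "finite I" "w ` I \<subseteq> S" "\<And>\<xi>. \<xi> \<in> dual_group \<Longrightarrow> P \<xi> = (\<Sum>i\<in>I. a i * \<xi> (w i))"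
  shows "trig_poly_on_dual S P"
  unfolding trig_poly_on_dual_def
proof (intro exI conjI ballI)
  show "finite (w ` I)" "w ` I \<subseteq> S" using assms by auto
  fix \<xi> :: "'a \<Rightarrow> complex" assume "\<xi> \<in> dual_group"
  then have "P \<xi> = (\<Sum>i\<in>I. a i * \<xi> (w i))" by (rule assms)
  also have "\<dots> = (\<Sum>\<gamma>\<in>w ` I. (\<Sum>i\<in>{i\<in>I. w i = \<gamma>}. a i * \<xi> (w i)))"
    by (rule sum.image_gen[OF assms(1)])
  also have "\<dots> = (\<Sum>\<gamma>\<in>w ` I. (\<Sum>i\<in>{i\<in>I. w i = \<gamma>}. a i) * \<xi> \<gamma>)"
    by (intro sum.cong refl) (simp add: sum_distrib_right)
  finally show "P \<xi> = (\<Sum>\<gamma>\<in>w ` I. (\<Sum>i\<in>{i\<in>I. w i = \<gamma>}. a i) * \<xi> \<gamma>)" .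
qed

lemma trig_poly_on_dual_mult:
  fixes U :: "'a::ab_group_add set"
  assumes "trig_poly_on_dual S P" "trig_poly_on_dual T Q" "\<And>s t. s \<in> S \<Longrightarrow> t \<in> T \<Longrightarrow> s + t \<in> U"
  shows "trig_poly_on_dual U (\<lambda>\<xi>. P \<xi> * Q \<xi>)"
proof -
  obtain F c where F: "finite F" "F \<subseteq> S" "\<And>\<xi>. \<xi>\<in>dual_group \<Longrightarrow> P \<xi> = (\<Sum>\<gamma>\<in>F. c \<gamma> * \<xi> \<gamma>)"
    using assms(1) unfolding trig_poly_on_dual_def by blast
  obtain H d where H: "finite H" "H \<subseteq> T" "\<And>\<xi>. \<xi>\<in>dual_group \<Longrightarrow> Q \<xi> = (\<Sum>\<gamma>\<in>H. d \<gamma> * \<xi> \<gamma>)"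
    using assms(2) unfolding trig_poly_on_dual_def by blast
  show ?thesis
  proof (rule trig_poly_on_dual_family)
    show "finite (F \<times> H)" using F H by simp
    show "(\<lambda>(\<gamma>, \<delta>). \<gamma> + \<delta>) ` (F \<times> H) \<subseteq> U" using F(2) H(2) assms(3) by auto
    fix \<xi> :: "'a \<Rightarrow> complex" assume \<xi>: "\<xi> \<in> dual_group"
    show "P \<xi> * Q \<xi> = (\<Sum>i\<in>F \<times> H. (case i of (\<gamma>, \<delta>) \<Rightarrow> c \<gamma> * d \<delta>) * \<xi> (case i of (\<gamma>, \<delta>) \<Rightarrow> \<gamma> + \<delta>))"
      unfolding F(3)[OF \<xi>] H(3)[OF \<xi>] sum_product sum.cartesian_product
      by (intro sum.cong refl) (auto simp: dual_groupD(2)[OF \<xi>])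
  qed
qed

lemma trig_poly_on_dual_add:
  fixes S :: "'a::ab_group_add set"
  assumes "trig_poly_on_dual S P" "trig_poly_on_dual S Q"
  shows "trig_poly_on_dual S (\<lambda>\<xi>. P \<xi> + Q \<xi>)"
proof -
  obtain F c where F: "finite F" "F \<subseteq> S" "\<And>\<xi>. \<xi>\<in>dual_group \<Longrightarrow> P \<xi> = (\<Sum>\<gamma>\<in>F. c \<gamma> * \<xi> \<gamma>)"
    using assms(1) unfolding trig_poly_on_dual_def by blast
  obtain H d where H: "finite H" "H \<subseteq> S" "\<And>\<xi>. \<xi>\<in>dual_group \<Longrightarrow> Q \<xi> = (\<Sum>\<gamma>\<in>H. d \<gamma> * \<xi> \<gamma>)"
    using assms(2) unfolding trig_poly_on_dual_def by blast
  show ?thesis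
  proof (rule trig_poly_on_dual_family)
    show "finite (F <+> H)" using F H by simp
    show "case_sum id id ` (F <+> H) \<subseteq> S" using F(2) H(2) by auto
    fix \<xi> :: "'a \<Rightarrow> complex" assume \<xi>: "\<xi> \<in> dual_group"
    show "P \<xi> + Q \<xi> = (\<Sum>i\<in>F <+> H. case_sum c d i * \<xi> (case_sum id id i))"
      using F(1) H(1) by (simp add: F(3)[OF \<xi>] H(3)[OF \<xi>] sum.Plus comp_def)
  qed
qed

lemma trig_poly_on_dual_monom: "\<gamma> \<in> S \<Longrightarrow> trig_poly_on_dual S (\<lambda>\<xi>. c * \<xi> \<gamma>)"
  by (rule trig_poly_on_dual_family[of "{\<gamma>}" id _ _ "\<lambda>_. c"]) auto

section \<open>Fourier analysis with respect to Haar measure\<close>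

locale haar =
  fixes \<mu> :: "('a::ab_group_add \<Rightarrow> complex) measure"
  assumes haar: "normalized_haar \<mu>"
begin

lemma sets_haar: "sets \<mu> = sets (restrict_space borel dual_group)"
  using haar by (simp add: normalized_haar_def)

lemma space_haar: "space \<mu> = dual_group"
  using sets_eq_imp_space_eq[OF sets_haar] by (simp add: space_restrict_space)

sublocale prob_space \<mu>
  using haar by (simp add: normalized_haar_def)

lemma measurable_continuous: "continuous_on dual_group f \<Longrightarrow> f \<in> borel_measurable \<mu>"
  using borel_measurable_continuous_on_restrict measurable_cong_sets[OF sets_haar refl] by blast

lemma integrable_continuous:
  fixes f :: "_ \<Rightarrow> 'b::{second_countable_topology, banach}"
  assumes "continuous_on dual_group f"
  shows "integrable \<mu> f"
proof -
  have "compact (f ` dual_group)" using compact_continuous_image[OF assms compact_dual_group] .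
  then obtain B where "\<And>\<xi>. \<xi> \<in> dual_group \<Longrightarrow> norm (f \<xi>) \<le> B"
    using compact_imp_bounded bounded_iff by (metis imageI)
  then show ?thesis
    by (intro integrable_const_bound[of _ B]) (auto simp: space_haar measurable_continuous assms)
qed

text \<open>Translation by a \<open>\<xi>\<close> with \<open>\<xi> \<gamma>\<close> different from
  \<open>1\<close> multiplies the integral by \<open>\<xi> \<gamma>\<close>, while invariance leaves
  it unchanged.\<close>

lemma integral_character:
  assumes "\<gamma> \<noteq> 0"
  shows "(LINT \<psi>|\<mu>. \<psi> \<gamma>) = 0"
proof -
  obtain \<xi> where \<xi>: "\<xi> \<in> dual_group" "\<xi> \<gamma> \<noteq> 1" using dual_group_separates[OF assms] by blast
  have d: "distr \<mu> \<mu> (\<lambda>\<psi> \<gamma>. \<xi> \<gamma> * \<psi> \<gamma>) = \<mu>"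
    using haar \<xi>(1) by (simp add: normalized_haar_def)
  have "(\<lambda>\<psi> \<gamma>. \<xi> \<gamma> * \<psi> \<gamma>) \<in> borel_measurable \<mu>"
    by (rule measurable_continuous) (intro continuous_intros continuous_on_eval)
  then have m: "(\<lambda>\<psi> \<gamma>. \<xi> \<gamma> * \<psi> \<gamma>) \<in> measurable \<mu> \<mu>"
    unfolding measurable_cong_sets[OF refl sets_haar]
    by (rule measurable_restrict_space2[rotated]) (auto simp: space_haar dual_group_mult_closed \<xi>)
  have "(LINT \<psi>|\<mu>. \<psi> \<gamma>) = (LINT \<psi>|distr \<mu> \<mu> (\<lambda>\<psi> \<gamma>. \<xi> \<gamma> * \<psi> \<gamma>). \<psi> \<gamma>)" by (simp add: d)
  also have "\<dots> = (LINT \<psi>|\<mu>. \<xi> \<gamma> * \<psi> \<gamma>)"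
    by (rule integral_distr[OF m]) (intro measurable_continuous continuous_intros continuous_on_eval)
  also have "\<dots> = \<xi> \<gamma> * (LINT \<psi>|\<mu>. \<psi> \<gamma>)" by simp
  finally show ?thesis using \<xi>(2) by simp
qed

lemma integral_character_eq: "(LINT \<psi>|\<mu>. \<psi> \<gamma>) = (if \<gamma> = 0 then 1 else 0)"
proof -
  have "(LINT \<psi>|\<mu>. \<psi> 0) = (LINT \<psi>|\<mu>. 1)"
    by (rule Bochner_Integration.integral_cong) (auto simp: space_haar dual_groupD)
  then show ?thesis using integral_character by (auto simp: prob_space)
qed

lemma fourier_character: "fourier \<mu> (\<lambda>\<xi>. \<xi> \<delta>) \<gamma> = (if \<delta> = \<gamma> then 1 else 0)"
proof -
  have "fourier \<mu> (\<lambda>\<xi>. \<xi> \<delta>) \<gamma> = (LINT \<psi>|\<mu>. \<psi> (\<delta> - \<gamma>))"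
    unfolding fourier_def
    by (rule Bochner_Integration.integral_cong) (auto simp: space_haar dual_groupD)
  then show ?thesis by (simp add: integral_character_eq)
qed

lemma integrable_ess_bounded_mult:
  fixes f g :: "('a \<Rightarrow> complex) \<Rightarrow> complex"
  assumes f: "f \<in> borel_measurable \<mu>" "AE \<xi> in \<mu>. norm (f \<xi>) \<le> B" and g: "continuous_on dual_group g"
  shows "integrable \<mu> (\<lambda>\<xi>. f \<xi> * g \<xi>)"
proof (rule Bochner_Integration.integrable_bound)
  show "integrable \<mu> (\<lambda>\<xi>. B * norm (g \<xi>))"
    by (intro integrable_continuous continuous_intros continuous_on_eval g)
  show "(\<lambda>\<xi>. f \<xi> * g \<xi>) \<in> borel_measurable \<mu>"
    using f(1) measurable_continuous[OF g] by simp
  show "AE \<xi> in \<mu>. norm (f \<xi> * g \<xi>) \<le> norm (B * norm (g \<xi>))"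
    using f(2) by eventually_elim
     (auto simp: norm_mult abs_mult intro!: mult_right_mono order_trans[OF _ abs_ge_self])
qed

lemma integral_ess_bounded_family:
  assumes f: "f \<in> borel_measurable \<mu>" "AE \<xi> in \<mu>. norm (f \<xi>) \<le> B"
    and K: "\<And>\<xi>. \<xi> \<in> dual_group \<Longrightarrow> K \<xi> = (\<Sum>i\<in>I. k i * cnj (\<xi> (w i)))"
  shows "(LINT \<xi>|\<mu>. f \<xi> * K \<xi>) = (\<Sum>i\<in>I. k i * fourier \<mu> f (w i))"
proof -
  have "(LINT \<xi>|\<mu>. f \<xi> * K \<xi>) = (LINT \<xi>|\<mu>. (\<Sum>i\<in>I. k i * (f \<xi> * cnj (\<xi> (w i)))))"
    by (rule Bochner_Integration.integral_cong) (auto simp: space_haar K sum_distrib_left ac_simps)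
  also have "\<dots> = (\<Sum>i\<in>I. LINT \<xi>|\<mu>. k i * (f \<xi> * cnj (\<xi> (w i))))"
    by (intro Bochner_Integration.integral_sum integrable_mult_right integrable_ess_bounded_mult[OF f] continuous_intros continuous_on_eval)
  finally show ?thesis by (simp add: fourier_def)
qed

lemma compact_sets_haar: "compact K \<Longrightarrow> K \<subseteq> dual_group \<Longrightarrow> K \<in> sets \<mu>"
  unfolding sets_haar sets_restrict_space
  using borel_closed[OF compact_imp_closed] by blast

lemma inner_regular_approx:
  assumes A: "A \<in> sets \<mu>" and e: "e > 0"
  shows "\<exists>K. K \<subseteq> A \<and> compact K \<and> measure \<mu> (A - K) < e"
proof -
  have AG: "A \<subseteq> dual_group" using sets.sets_into_space[OF A] by (simp add: space_haar)
  have eq: "emeasure \<mu> A = (SUP K\<in>{K. K \<subseteq> A \<and> compact K}. emeasure \<mu> K)"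
    using haar A by (simp add: normalized_haar_def)
  have "\<exists>K\<in>{K. K \<subseteq> A \<and> compact K}. emeasure \<mu> A < emeasure \<mu> K + ennreal e"
    unfolding eq using e emeasure_finite[of A] eq
    by (intro SUP_approx_ennreal[OF _ _ refl]) (auto simp: ennreal_zero_less_top)
  then obtain K where K: "K \<subseteq> A" "compact K" "emeasure \<mu> A < emeasure \<mu> K + ennreal e" by blast
  have Ks: "K \<in> sets \<mu>" using K AG compact_sets_haar by blast
  have "measure \<mu> A < measure \<mu> K + e"
    using K(3) e by (simp add: emeasure_eq_measure ennreal_less_iff flip: ennreal_plus)
  then show ?thesis using K finite_measure_Diff[OF A Ks K(1)] by auto
qed

text \<open>This supplies the hypotheses of the Stone-Weierstrass theorem. Conjugating a character
  negates its frequency, so real and imaginary parts of characters are trigonometric polynomials,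
  and they separate points.\<close>

lemma real_trig_ring:
  "function_ring_on {f. trig_poly_on_dual UNIV (\<lambda>\<xi>. complex_of_real (f \<xi>))} (dual_group :: ('a \<Rightarrow> complex) set)"
proof
  show "compact (dual_group :: ('a \<Rightarrow> complex) set)" by (rule compact_dual_group)
next
  fix f assume "f \<in> {f. trig_poly_on_dual UNIV (\<lambda>\<xi>::'a\<Rightarrow>complex. complex_of_real (f \<xi>))}"
  then obtain F c where Fc: "\<And>\<xi>::'a\<Rightarrow>complex. \<xi>\<in>dual_group \<Longrightarrow> complex_of_real (f \<xi>) = (\<Sum>\<gamma>\<in>F. c \<gamma> * \<xi> \<gamma>)"
    unfolding trig_poly_on_dual_def by blast
  then have *: "f \<xi> = Re (\<Sum>\<gamma>\<in>F. c \<gamma> * \<xi> \<gamma>)" if "\<xi> \<in> dual_group" for \<xi> :: "'a\<Rightarrow>complex"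
    using that by (metis Re_complex_of_real)
  have "continuous_on dual_group (\<lambda>\<xi>::'a\<Rightarrow>complex. Re (\<Sum>\<gamma>\<in>F. c \<gamma> * \<xi> \<gamma>))"
    by (intro continuous_intros continuous_on_eval)
  then show "continuous_on dual_group f" using * by (simp cong: continuous_on_cong)
next
  fix f g assume "f \<in> {f. trig_poly_on_dual UNIV (\<lambda>\<xi>::'a\<Rightarrow>complex. complex_of_real (f \<xi>))}"
    "g \<in> {f. trig_poly_on_dual UNIV (\<lambda>\<xi>::'a\<Rightarrow>complex. complex_of_real (f \<xi>))}"
  then show "(\<lambda>x. f x + g x) \<in> {f. trig_poly_on_dual UNIV (\<lambda>\<xi>. complex_of_real (f \<xi>))}"
    "(\<lambda>x. f x * g x) \<in> {f. trig_poly_on_dual UNIV (\<lambda>\<xi>. complex_of_real (f \<xi>))}"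
    by (auto intro: trig_poly_on_dual_add trig_poly_on_dual_mult)
next
  fix c
  show "(\<lambda>_. c) \<in> {f. trig_poly_on_dual UNIV (\<lambda>\<xi>::'a\<Rightarrow>complex. complex_of_real (f \<xi>))}"
    using trig_poly_on_dual_family[of "{0::'a}" id UNIV _ "\<lambda>_. complex_of_real c"] by (simp add: dual_groupD)
next
  fix x y :: "'a \<Rightarrow> complex" assume xy: "x \<in> dual_group" "y \<in> dual_group" "x \<noteq> y"
  then obtain \<gamma> where \<gamma>: "x \<gamma> \<noteq> y \<gamma>" by blast
  have "trig_poly_on_dual UNIV (\<lambda>\<xi>::'a\<Rightarrow>complex. 1/2 * \<xi> \<gamma> + 1/2 * \<xi> (- \<gamma>))"
    "trig_poly_on_dual UNIV (\<lambda>\<xi>::'a\<Rightarrow>complex. 1/(2*\<i>) * \<xi> \<gamma> + (- 1/(2*\<i>)) * \<xi> (- \<gamma>))"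
    by (intro trig_poly_on_dual_add trig_poly_on_dual_monom UNIV_I)+
  moreover have "1/2 * \<xi> \<gamma> + 1/2 * \<xi> (- \<gamma>) = of_real (Re (\<xi> \<gamma>))"
    "1/(2*\<i>) * \<xi> \<gamma> + (- 1/(2*\<i>)) * \<xi> (- \<gamma>) = of_real (Im (\<xi> \<gamma>))" if "\<xi> \<in> dual_group" for \<xi> :: "'a\<Rightarrow>complex"
    unfolding dual_groupD(4)[OF that] by (auto simp: complex_eq_iff Re_divide Im_divide)
  ultimately have R: "(\<lambda>\<xi>. Re (\<xi> \<gamma>)) \<in> {f. trig_poly_on_dual UNIV (\<lambda>\<xi>. complex_of_real (f \<xi>))}"
    and I: "(\<lambda>\<xi>. Im (\<xi> \<gamma>)) \<in> {f. trig_poly_on_dual UNIV (\<lambda>\<xi>. complex_of_real (f \<xi>))}"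
    by (simp_all add: trig_poly_on_dual_def)
  show "\<exists>f\<in>{f. trig_poly_on_dual UNIV (\<lambda>\<xi>. complex_of_real (f \<xi>))}. f x \<noteq> f y"
  proof (cases "Re (x \<gamma>) = Re (y \<gamma>)")
    case True
    then have "Im (x \<gamma>) \<noteq> Im (y \<gamma>)" using \<gamma> complex_eqI by blast
    then show ?thesis by (rule bexI[OF _ I])
  next
    case False
    then show ?thesis by (rule bexI[OF _ R])
  qed
qed

text \<open>Inner regularity and the Stone-Weierstrass theorem approximate the indicator of any Borel set by
  trigonometric polynomials; this covers the non-metrizable case, where continuous functions alone
  do not obviously determine a Borel measure.\<close>

lemma fourier_unique:
  assumes h: "h \<in> borel_measurable \<mu>" "AE \<xi> in \<mu>. norm (h \<xi>) \<le> B" and z: "\<And>\<gamma>. fourier \<mu> h \<gamma> = 0"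
  shows "AE \<xi> in \<mu>. h \<xi> = 0"
proof (rule density_zero)
  show int: "integrable \<mu> h" using integrable_const_bound[OF h(2,1)] .
  fix A assume A: "A \<in> sets \<mu>"
  have Ac: "dual_group - A \<in> sets \<mu>" using sets.compl_sets[OF A] by (simp add: space_haar)
  have B0: "0 \<le> B"
    using h(2) AE_const by (smt (verit) eventually_mono norm_ge_zero)
  \<comment> \<open>The real trigonometric polynomial \<open>f\<close> below is within
    \<open>e\<close> of the indicator of \<open>A\<close> on the compact sets \<open>K\<close> and
    \<open>L\<close>; the two remaining sets have measure below \<open>e\<close> each. This is where
    the factor \<open>3\<close> comes from.\<close>
  have est: "norm (set_lebesgue_integral \<mu> A h) \<le> (3 * B) * e" if e: "0 < e" "e < 1" for e
  proof -
    obtain K where K: "K \<subseteq> A" "compact K" "measure \<mu> (A - K) < e"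
      using inner_regular_approx[OF A e(1)] by blast
    obtain L where L: "L \<subseteq> dual_group - A" "compact L" "measure \<mu> (dual_group - A - L) < e"
      using inner_regular_approx[OF Ac e(1)] by blast
    have AG: "A \<subseteq> dual_group" using sets.sets_into_space[OF A] by (simp add: space_haar)
    have KG: "K \<subseteq> dual_group" "L \<subseteq> dual_group" using K(1) L(1) AG by auto
    then have KL: "K \<in> sets \<mu>" "L \<in> sets \<mu>" using K(2) L(2) compact_sets_haar by auto
    obtain f where f: "trig_poly_on_dual UNIV (\<lambda>\<xi>. complex_of_real (f \<xi>))" "f ` dual_group \<subseteq> {0..1}"
      "\<And>x. x \<in> L \<Longrightarrow> f x < e" "\<And>x. x \<in> K \<Longrightarrow> f x > 1 - e"
      using function_ring_on.two[OF real_trig_ring compact_imp_closed[OF L(2)] _ compact_imp_closed[OF K(2)] _ _ e]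
        K L AG by blast
    have fc: "continuous_on dual_group f"
      using function_ring_on.continuous[OF real_trig_ring] f(1) by blast
    obtain F c where Fc: "\<And>\<xi>. \<xi>\<in>dual_group \<Longrightarrow> complex_of_real (f \<xi>) = (\<Sum>\<gamma>\<in>F. c \<gamma> * \<xi> \<gamma>)"
      using f(1) unfolding trig_poly_on_dual_def by blast
    have "(LINT \<xi>|\<mu>. h \<xi> * complex_of_real (f \<xi>)) = (\<Sum>\<gamma>\<in>F. c \<gamma> * fourier \<mu> h (- \<gamma>))"
      by (rule integral_ess_bounded_family[OF h]) (simp add: Fc dual_groupD(4))
    then have 0: "(LINT \<xi>|\<mu>. h \<xi> * complex_of_real (f \<xi>)) = 0" by (simp add: z)
    have ih: "integrable \<mu> (\<lambda>\<xi>. indicator A \<xi> *\<^sub>R h \<xi>)"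
      using integrable_mult_indicator[OF A int] .
    have ihf: "integrable \<mu> (\<lambda>\<xi>. h \<xi> * complex_of_real (f \<xi>))"
      by (intro integrable_ess_bounded_mult[OF h] continuous_intros fc)
    have "norm (set_lebesgue_integral \<mu> A h)
        = norm (LINT \<xi>|\<mu>. indicator A \<xi> *\<^sub>R h \<xi> - h \<xi> * complex_of_real (f \<xi>))"
      unfolding set_lebesgue_integral_def using ih ihf 0 by simp
    also have "\<dots> \<le> (LINT \<xi>|\<mu>. norm (indicator A \<xi> *\<^sub>R h \<xi> - h \<xi> * complex_of_real (f \<xi>)))"
      by (rule integral_norm_bound)
    also have "\<dots> \<le> (LINT \<xi>|\<mu>. B * (e + (indicator (A - K) \<xi> + indicator (dual_group - A - L) \<xi>)))"
    proof (rule integral_mono_AE)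
      show "integrable \<mu> (\<lambda>\<xi>. norm (indicator A \<xi> *\<^sub>R h \<xi> - h \<xi> * complex_of_real (f \<xi>)))"
        using ih ihf by simp
      show "integrable \<mu> (\<lambda>\<xi>. B * (e + (indicator (A - K) \<xi> + indicator (dual_group - A - L) \<xi>)))"
        using A Ac KL by (intro integrable_mult_right integrable_add integrable_const integrable_real_indicator)
          (auto simp: emeasure_eq_measure)
      show "AE \<xi> in \<mu>. norm (indicator A \<xi> *\<^sub>R h \<xi> - h \<xi> * complex_of_real (f \<xi>))
          \<le> B * (e + (indicator (A - K) \<xi> + indicator (dual_group - A - L) \<xi>))"
        using h(2) AE_space
      proof eventually_elim
        fix \<xi> assume *: "norm (h \<xi>) \<le> B" "\<xi> \<in> space \<mu>"
        then have g: "\<xi> \<in> dual_group" by (simp add: space_haar)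
        have "indicator A \<xi> *\<^sub>R h \<xi> - h \<xi> * complex_of_real (f \<xi>) = h \<xi> * of_real (indicator A \<xi> - f \<xi>)"
          by (simp add: scaleR_conv_of_real algebra_simps)
        moreover have "0 \<le> f \<xi>" "f \<xi> \<le> 1" using f(2) g by auto
        then have "\<bar>indicator A \<xi> - f \<xi>\<bar> \<le> e + (indicator (A - K) \<xi> + indicator (dual_group - A - L) \<xi>)"
          using f(3)[of \<xi>] f(4)[of \<xi>] e g K(1) L(1) by (auto simp: indicator_def)
        ultimately show "norm (indicator A \<xi> *\<^sub>R h \<xi> - h \<xi> * complex_of_real (f \<xi>))
          \<le> B * (e + (indicator (A - K) \<xi> + indicator (dual_group - A - L) \<xi>))"
          using * B0 by (simp add: norm_mult mult_mono del: of_real_diff)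
      qed
    qed
    also have "\<dots> = B * (e + (measure \<mu> (A - K) + measure \<mu> (dual_group - A - L)))"
      using A Ac KL sets.sets_into_space[OF A]
      by (simp add: integrable_real_indicator emeasure_eq_measure prob_space[unfolded space_haar] Int_absorb2 space_haar
          Bochner_Integration.integral_add subset_iff)
    also have "\<dots> \<le> B * (e + (e + e))" using K(3) L(3) B0 by (intro mult_left_mono) auto
    finally show ?thesis by simp
  qed
  have "((\<lambda>e. (3 * B) * e) \<longlongrightarrow> (3 * B) * 0) (at_right 0)" by (intro tendsto_intros)
  then have "norm (set_lebesgue_integral \<mu> A h) \<le> 3 * B * 0"
  proof (rule tendsto_lowerbound)
    show "\<forall>\<^sub>F e in at_right 0. norm (set_lebesgue_integral \<mu> A h) \<le> 3 * B * e"
      using est by (auto simp: eventually_at_right_field intro!: exI[of _ 1])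
  qed simp
  then show "set_lebesgue_integral \<mu> A h = 0" by simp
qed

end

section \<open>Block systems and their Riesz-type kernels\<close>

text \<open>Unlike in \<open>trig_poly_on_dual_family\<close>, the identity holds for every
  \<open>\<psi>\<close>, not only for characters; one and the same \<open>k\<close> can thus be
  tested against Fourier coefficients.\<close>

lemma collect_coefficients:
  fixes w :: "'i \<Rightarrow> 'a" and a :: "'i \<Rightarrow> complex"
  assumes "finite I" "finite S" "w ` I \<subseteq> S"
  shows "\<exists>k. \<forall>\<psi>. (\<Sum>\<gamma>\<in>S. k \<gamma> * \<psi> \<gamma>) = (\<Sum>i\<in>I. a i * \<psi> (w i))"
proof (intro exI allI)
  fix \<psi> :: "'a \<Rightarrow> complex"
  have "(\<Sum>i\<in>I. a i * \<psi> (w i)) = (\<Sum>\<gamma>\<in>S. \<Sum>i\<in>{i\<in>I. w i = \<gamma>}. a i * \<psi> (w i))"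
    by (rule sum.group[OF assms, symmetric])
  also have "\<dots> = (\<Sum>\<gamma>\<in>S. (\<Sum>i\<in>{i\<in>I. w i = \<gamma>}. a i) * \<psi> \<gamma>)"
    by (intro sum.cong refl) (simp add: sum_distrib_right)
  finally show "(\<Sum>\<gamma>\<in>S. (\<Sum>i\<in>{i\<in>I. w i = \<gamma>}. a i) * \<psi> \<gamma>) = (\<Sum>i\<in>I. a i * \<psi> (w i))" by simp
qed

definition difference_set :: "'a::ab_group_add set \<Rightarrow> 'a set" where
  "difference_set S = (\<lambda>(b, b'). b' - b) ` (S \<times> S)"

text \<open>Divided by \<open>card S\<close>, this is the Fourier coefficient at \<open>c\<close> of
  \<open>|\<Sum>\<^sub>b \<xi>(b)|\<^sup>2 / |S|\<close> with \<open>b\<close> in \<open>S\<close>,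
  a kernel of Fejer type. It is close to \<open>1\<close> if \<open>S\<close> is almost invariant
  under translation by \<open>c\<close>.\<close>

definition diff_count :: "'a::ab_group_add set \<Rightarrow> 'a \<Rightarrow> nat" where
  "diff_count S c = card {(b, b') \<in> S \<times> S. b' - b = c}"

lemma difference_set_mem: "b \<in> S \<Longrightarrow> b' \<in> S \<Longrightarrow> b' - b \<in> difference_set S"
  unfolding difference_set_def by (rule image_eqI[of _ _ "(b, b')"]) auto

lemma diff_count_le:
  assumes "finite S"
  shows "diff_count S c \<le> card S"
proof -
  have "inj_on fst {(b, b') \<in> S \<times> S. b' - b = c}"
    by (rule inj_onI) (auto simp: algebra_simps)
  then show ?thesis
    unfolding diff_count_def using assms by (intro card_inj_on_le[of fst]) auto
qed

text \<open>\<open>T n\<close> contains all frequencies that occur in the product of the first \<open>n\<close> kernel factors. The assumptions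
  from \<open>diff_T\<close> to \<open>\<theta>_double\<close> say that the \<open>n\<close>-th factor creates no frequency in \<open>E\<close> or \<open>0\<close> other than the
  intended ones; the exception \<open>\<theta> n + \<theta> n = 0\<close> is unavoidable in groups of exponent \<open>2\<close>.\<close>

locale block_system =
  fixes A B C T :: "nat \<Rightarrow> 'a::ab_group_add set" and \<theta> :: "nat \<Rightarrow> 'a"
  assumes card_A: "n < card (A n)"
    and doubling: "card ((\<lambda>(a, b). a + b) ` (A n \<times> A n)) \<le> 2 * card (A n)"
    and sums_in_C: "set l \<subseteq> A n \<Longrightarrow> length l \<le> n \<Longrightarrow> sum_list l \<in> C n"
    and finite_B: "finite (B n)" and B_nonempty: "B n \<noteq> {}"
    and finite_C: "finite (C n)" and C_subset: "C n \<subseteq> difference_set (B n)"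
    and finite_T: "finite (T n)" and zero_in_T: "0 \<in> T 0"
    and T_step: "s \<in> T n \<Longrightarrow> v \<in> difference_set (B n) \<Longrightarrow> e \<in> {0, \<theta> n, - \<theta> n} \<Longrightarrow> s + v + e \<in> T (Suc n)"
    and diff_T: "s \<in> T n \<Longrightarrow> t \<in> T n \<Longrightarrow> v \<in> difference_set (B n) \<Longrightarrow> s + v = t \<Longrightarrow> v = 0"
    and diff_C: "s \<in> T n \<Longrightarrow> v \<in> difference_set (B n) \<Longrightarrow> c \<in> C n \<Longrightarrow> s + v = c \<Longrightarrow> s = 0"
    and \<theta>_C: "s \<in> T n \<Longrightarrow> v \<in> difference_set (B n) \<Longrightarrow> c \<in> C n \<Longrightarrow> s + v \<noteq> \<theta> n + c"
    and \<theta>_plus: "s \<in> T n \<Longrightarrow> t \<in> T n \<Longrightarrow> v \<in> difference_set (B n) \<Longrightarrow> s + v + \<theta> n \<noteq> t"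
    and \<theta>_minus: "s \<in> T n \<Longrightarrow> t \<in> T n \<Longrightarrow> v \<in> difference_set (B n) \<Longrightarrow> s + v - \<theta> n \<noteq> t"
    and \<theta>_double: "s \<in> T n \<Longrightarrow> v \<in> difference_set (B n) \<Longrightarrow> c \<in> C n \<Longrightarrow> s + v - \<theta> n = \<theta> n + c \<Longrightarrow> \<theta> n + \<theta> n = 0"
    and almost_invariant: "(\<Sum>c\<in>C n. 1 - diff_count (B n) c / card (B n)) \<le> (1 / 2) ^ n"
begin

definition E :: "'a set" where "E = (\<Union>n. (+) (\<theta> n) ` C n)"

lemma E_iff: "\<gamma> \<in> E \<longleftrightarrow> (\<exists>n. \<exists>c\<in>C n. \<gamma> = \<theta> n + c)"
  by (auto simp: E_def)

lemma zero_in_diffs: "0 \<in> difference_set (B n)"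
proof -
  obtain b where "b \<in> B n" using B_nonempty by blast
  then show ?thesis using difference_set_mem[of b "B n" b] by simp
qed

lemma T_mono: "m \<le> n \<Longrightarrow> T m \<subseteq> T n"
  by (rule lift_Suc_mono_le[of T]) (use T_step[OF _ zero_in_diffs, of _ _ 0] in auto)

lemma zero_in_T': "0 \<in> T n"
  using T_mono[of 0 n] zero_in_T by blast

lemma block_in_T: "m < n \<Longrightarrow> c \<in> C m \<Longrightarrow> \<theta> m + c \<in> T n"
  using T_step[OF zero_in_T', of c m "\<theta> m"] C_subset[of m] T_mono[of "Suc m" n]
  by (auto simp: add.commute)

lemma T_not_later_block:
  assumes "n < m" "\<gamma> \<in> T (Suc n)" "c \<in> C m"
  shows "\<gamma> \<noteq> \<theta> m + c"
  using \<theta>_C[OF _ zero_in_diffs assms(3), of \<gamma>] T_mono[of "Suc n" m] assms by auto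

text \<open>Zero and the earlier blocks lie in \<open>T n\<close>, which assumption \<open>T\<close>
  excludes; block \<open>n\<close> is excluded by assumption \<open>C\<close>. Later blocks are out
  of reach since \<open>s + v + e\<close> lies in \<open>T (Suc n)\<close>.\<close>

lemma shift_not_in_E:
  assumes s: "s \<in> T n" and v: "v \<in> difference_set (B n)" and e: "e \<in> {0, \<theta> n, - \<theta> n}"
    and T: "\<And>t. t \<in> T n \<Longrightarrow> s + v + e \<noteq> t" and C: "\<And>c. c \<in> C n \<Longrightarrow> s + v + e \<noteq> \<theta> n + c"
  shows "s + v + e \<notin> insert 0 E"
proof
  assume "s + v + e \<in> insert 0 E"
  then consider "s + v + e = 0" | m c where "c \<in> C m" "s + v + e = \<theta> m + c"
    by (auto simp: E_iff)
  then show False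
  proof cases
    case 1
    then show False using T[OF zero_in_T'] by simp
  next
    case 2
    consider "m < n" | "m = n" | "n < m" by linarith
    then show False
    proof cases
      case 1
      then show False using T[OF block_in_T[OF 1 2(1)]] 2(2) by simp
    next
      case 2: 2
      then show False using C \<open>c \<in> C m\<close> \<open>s + v + e = \<theta> m + c\<close> by blast
    next
      case 3
      then show False using T_not_later_block[OF 3 T_step[OF s v e] 2(1)] 2(2) by blast
    qed
  qed
qed

lemma zero_notin_E: "0 \<notin> E"
proof
  assume "0 \<in> E"
  then obtain n c where "c \<in> C n" "0 = \<theta> n + c" by (auto simp: E_iff)
  then show False using \<theta>_C[OF zero_in_T' zero_in_diffs, of c n] by simp
qed

text \<open>This lets the sum over all differences of \<open>B n\<close> be cut down to
  \<open>C n\<close> when the coefficients vanish off \<open>E\<close>.\<close>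

lemma shifted_diff_in_E:
  assumes v: "v \<in> difference_set (B n)" and E: "\<theta> n + v \<in> E"
  shows "v \<in> C n"
proof (rule ccontr)
  assume "v \<notin> C n"
  then have "0 + v + \<theta> n \<notin> insert 0 E"
    using \<theta>_plus[OF zero_in_T' _ v] by (intro shift_not_in_E[OF zero_in_T' v]) (auto simp: add.commute)
  then show False using E by (simp add: add.commute)
qed

text \<open>In \<open>Re \<xi>(\<theta> n)\<close> the frequencies \<open>\<theta> n\<close> and \<open>- \<theta> n\<close> have weight \<open>1/2\<close> each; they add up when they coincide.\<close>

definition \<kappa> :: "nat \<Rightarrow> real" where "\<kappa> n = (if \<theta> n + \<theta> n = 0 then 1 else 1 / 2)"

text \<open>For \<open>\<phi>\<close> the Fourier transform of a function with spectrum in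
  \<open>E\<close>, this is block \<open>n\<close> of its Fourier series with Fejer weights,
  evaluated at \<open>x\<close> without the factor \<open>x (\<theta> n)\<close> and scaled by
  \<open>\<kappa> n\<close>.\<close>

definition block_form :: "nat \<Rightarrow> ('a \<Rightarrow> complex) \<Rightarrow> ('a \<Rightarrow> complex) \<Rightarrow> complex" where
  "block_form n x \<phi> =
    of_real (\<kappa> n) * (\<Sum>(b, b')\<in>B n \<times> B n. x (b' - b) / of_nat (card (B n)) * \<phi> (\<theta> n + (b' - b)))"

definition factor :: "nat \<Rightarrow> real \<Rightarrow> ('a \<Rightarrow> complex) \<Rightarrow> ('a \<Rightarrow> complex) \<Rightarrow> real" where
  "factor n u x \<xi> = (norm (\<Sum>b\<in>B n. \<xi> b * cnj (x b)))\<^sup>2 / card (B n) * (1 + u * Re (\<xi> (\<theta> n)))"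

text \<open>The expansion uses conjugate characters, so that integration against \<open>f\<close>
  produces Fourier coefficients of \<open>f\<close> directly.\<close>

lemma factor_eq:
  assumes x: "x \<in> dual_group" and \<xi>: "\<xi> \<in> dual_group"
  shows "complex_of_real (factor n u x \<xi>) = (\<Sum>(b, b')\<in>B n \<times> B n. x (b' - b) / of_nat (card (B n)) *
    (cnj (\<xi> (b' - b)) + of_real u / 2 * cnj (\<xi> (b' - b + \<theta> n)) + of_real u / 2 * cnj (\<xi> (b' - b - \<theta> n))))"
proof -
  have "complex_of_real ((norm (\<Sum>b\<in>B n. \<xi> b * cnj (x b)))\<^sup>2)
      = (\<Sum>b\<in>B n. \<xi> b * cnj (x b)) * (\<Sum>b'\<in>B n. cnj (\<xi> b') * x b')"
    by (simp only: complex_norm_square cnj_sum complex_cnj_mult complex_cnj_cnj)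
  also have "\<dots> = (\<Sum>(b, b')\<in>B n \<times> B n. x (b' - b) * cnj (\<xi> (b' - b)))"
    unfolding sum_product sum.cartesian_product
    by (intro sum.cong refl) (auto simp: dual_groupD(5)[OF x] dual_groupD(5)[OF \<xi>])
  finally have 1: "complex_of_real ((norm (\<Sum>b\<in>B n. \<xi> b * cnj (x b)))\<^sup>2) = \<dots>" .
  have 2: "complex_of_real (1 + u * Re (\<xi> (\<theta> n))) = 1 + of_real u / 2 * cnj (\<xi> (\<theta> n)) + of_real u / 2 * \<xi> (\<theta> n)"
    by (simp add: complex_eq_iff)
  have "complex_of_real (factor n u x \<xi>) = (\<Sum>(b, b')\<in>B n \<times> B n. x (b' - b) * cnj (\<xi> (b' - b)))
      / of_nat (card (B n)) * (1 + of_real u / 2 * cnj (\<xi> (\<theta> n)) + of_real u / 2 * \<xi> (\<theta> n))"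
    unfolding factor_def of_real_mult 2 of_real_divide 1 by simp
  also have "\<dots> = (\<Sum>(b, b')\<in>B n \<times> B n. x (b' - b) / of_nat (card (B n)) *
    (cnj (\<xi> (b' - b)) + of_real u / 2 * cnj (\<xi> (b' - b + \<theta> n)) + of_real u / 2 * cnj (\<xi> (b' - b - \<theta> n))))"
    unfolding sum_divide_distrib sum_distrib_right
    by (intro sum.cong refl, clarify, simp only: dual_groupD(2)[OF \<xi>, of _ "\<theta> n"]
        dual_groupD(5)[OF \<xi>, of _ "\<theta> n"] complex_cnj_mult complex_cnj_cnj)
      (simp add: algebra_simps)
  finally show ?thesis .
qed

lemma factor_nonneg:
  assumes "\<bar>u\<bar> \<le> 1" and \<xi>: "\<xi> \<in> dual_group"
  shows "0 \<le> factor n u x \<xi>"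
proof -
  have "\<bar>Re (\<xi> (\<theta> n))\<bar> \<le> 1" using abs_Re_le_cmod[of "\<xi> (\<theta> n)"] dual_groupD(1)[OF \<xi>] by simp
  then have "\<bar>u * Re (\<xi> (\<theta> n))\<bar> \<le> 1" using assms(1) by (simp add: abs_mult mult_le_one)
  then show ?thesis unfolding factor_def by (intro mult_nonneg_nonneg) auto
qed

text \<open>Factor \<open>n\<close> moves a frequency \<open>s\<close> to \<open>s + v + e\<close>.
  For \<open>e = 0\<close> only \<open>v = 0\<close> can stay in \<open>insert 0 E\<close>; for
  \<open>e = \<theta> n\<close> this needs \<open>s = 0\<close>, and for
  \<open>e = - \<theta> n\<close> it needs \<open>\<theta> n + \<theta> n = 0\<close> as well. Hence
  the factor reproduces \<open>\<phi> s\<close> and adds a new term at \<open>s = 0\<close>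
  alone.\<close>

lemma factor_action:
  assumes x: "x \<in> dual_group" and s: "s \<in> T n"
    and \<phi>: "\<And>\<gamma>. \<gamma> \<notin> insert 0 E \<Longrightarrow> \<phi> \<gamma> = 0"
  shows "(\<Sum>(b, b')\<in>B n \<times> B n. x (b' - b) / of_nat (card (B n)) *
    (\<phi> (s + (b' - b)) + of_real u / 2 * \<phi> (s + (b' - b + \<theta> n)) + of_real u / 2 * \<phi> (s + (b' - b - \<theta> n))))
    = \<phi> s + (if s = 0 then of_real u * block_form n x \<phi> else 0)" (is "?L = _")
proof -
  have e0: "\<phi> (s + v) = (if v = 0 then \<phi> s else 0)" if v: "v \<in> difference_set (B n)" for v
  proof -
    have "s + v + 0 \<notin> insert 0 E" if "v \<noteq> 0"
      using diff_T[OF s _ v] \<theta>_C[OF s v] that by (intro shift_not_in_E[OF s v]) auto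
    then show ?thesis using \<phi> by auto
  qed
  have e1: "\<phi> (s + (v + \<theta> n)) = (if s = 0 then \<phi> (\<theta> n + v) else 0)" if v: "v \<in> difference_set (B n)" for v
  proof -
    have "s + v + \<theta> n \<notin> insert 0 E" if "s \<noteq> 0"
      using \<theta>_plus[OF s _ v] diff_C[OF s v] that
      by (intro shift_not_in_E[OF s v]) (auto simp: add.commute)
    then show ?thesis using \<phi> by (auto simp: add.commute add.left_commute)
  qed
  have e2: "\<phi> (s + (v - \<theta> n)) = (if s = 0 \<and> \<theta> n + \<theta> n = 0 then \<phi> (\<theta> n + v) else 0)"
    if v: "v \<in> difference_set (B n)" for v
  proof (cases "\<theta> n + \<theta> n = 0")
    case True
    have "v - \<theta> n = v + \<theta> n" using minus_unique[OF True] by (simp only: diff_conv_add_uminus)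
    then show ?thesis using e1[OF v] True by (simp only: simp_thms)
  next
    case False
    have "s + v + - \<theta> n \<notin> insert 0 E"
      using \<theta>_minus[OF s _ v] \<theta>_double[OF s v] False by (intro shift_not_in_E[OF s v]) auto
    then show ?thesis using \<phi> False by (auto simp: algebra_simps)
  qed
  have e: "\<phi> (s + v) + of_real u / 2 * \<phi> (s + (v + \<theta> n)) + of_real u / 2 * \<phi> (s + (v - \<theta> n))
      = (if v = 0 then \<phi> s else 0) + (if s = 0 then of_real u * (of_real (\<kappa> n) * \<phi> (\<theta> n + v)) else 0)"
    if v: "v \<in> difference_set (B n)" for v
    unfolding e0[OF v] e1[OF v] e2[OF v] \<kappa>_def by (simp add: field_simps)
  have "?L = (\<Sum>(b, b')\<in>B n \<times> B n. x (b' - b) / of_nat (card (B n)) * (if b' = b then \<phi> s else 0)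
      + (if s = 0 then of_real u * (of_real (\<kappa> n) * (x (b' - b) / of_nat (card (B n)) * \<phi> (\<theta> n + (b' - b)))) else 0))"
    by (intro sum.cong refl, clarify, subst e[OF difference_set_mem]) (auto simp: algebra_simps)
  also have "\<dots> = (\<Sum>(b, b')\<in>B n \<times> B n. x (b' - b) / of_nat (card (B n)) * (if b' = b then \<phi> s else 0))
      + (if s = 0 then of_real u * block_form n x \<phi> else 0)"
    by (simp add: block_form_def sum.distrib sum_distrib_left case_prod_unfold)
  \<comment> \<open>The diagonal consists of \<open>card (B n)\<close> pairs of weight
    \<open>1 / card (B n)\<close>.\<close>
  also have "(\<Sum>(b, b')\<in>B n \<times> B n. x (b' - b) / of_nat (card (B n)) * (if b' = b then \<phi> s else 0))
      = (\<Sum>b\<in>B n. \<Sum>b'\<in>B n. if b' = b then \<phi> s / of_nat (card (B n)) else 0)"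
    unfolding sum.cartesian_product by (intro sum.cong refl) (auto simp: dual_groupD(3)[OF x])
  also have "\<dots> = \<phi> s"
    using finite_B[of n] B_nonempty[of n] by (simp add: sum.delta')
  finally show ?thesis .
qed

text \<open>Because of this, the kernel keeps the coefficient \<open>1\<close> at frequency
  \<open>0\<close> and has integral \<open>1\<close>.\<close>

lemma block_form_delta: "block_form n x (\<lambda>\<gamma>. if \<gamma> = 0 then 1 else 0) = 0"
proof -
  have "\<theta> n + v \<noteq> 0" if "v \<in> difference_set (B n)" for v
    using \<theta>_plus[OF zero_in_T' zero_in_T' that] by (simp add: add.commute)
  then show ?thesis
    unfolding block_form_def by (auto intro!: sum.neutral simp: difference_set_mem)
qed

text \<open>The second conjunct evaluates the kernel at an arbitrary coefficient function \<open>\<phi>\<close> instead of a Fourier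
  transform: the delta function at \<open>0\<close> then yields the constant coefficient needed in the induction step.\<close>

lemma kernel_expansion:
  assumes x: "\<And>n. x n \<in> dual_group"
  shows "\<exists>k. (\<forall>\<xi>\<in>dual_group. complex_of_real (\<Prod>n<N. factor n (u n) (x n) \<xi>) = (\<Sum>\<gamma>\<in>T N. k \<gamma> * cnj (\<xi> \<gamma>)))
    \<and> (\<forall>\<phi>. (\<forall>\<gamma>. \<gamma> \<notin> insert 0 E \<longrightarrow> \<phi> \<gamma> = 0) \<longrightarrow>
      (\<Sum>\<gamma>\<in>T N. k \<gamma> * \<phi> \<gamma>) = \<phi> 0 + (\<Sum>n<N. of_real (u n) * block_form n (x n) \<phi>))"
proof (induction N)
  case 0
  show ?case
    using finite_T[of 0] zero_in_T
    by (intro exI[of _ "\<lambda>\<gamma>. if \<gamma> = 0 then 1 else 0"])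
      (auto simp: if_distrib[of "\<lambda>z. z * _"] sum.delta dual_groupD cong: if_cong)
next
  case (Suc N)
  then obtain k where k: "\<And>\<xi>. \<xi>\<in>dual_group \<Longrightarrow>
      complex_of_real (\<Prod>n<N. factor n (u n) (x n) \<xi>) = (\<Sum>\<gamma>\<in>T N. k \<gamma> * cnj (\<xi> \<gamma>))"
    and k2: "\<And>\<phi>. (\<And>\<gamma>. \<gamma> \<notin> insert 0 E \<Longrightarrow> \<phi> \<gamma> = 0) \<Longrightarrow>
      (\<Sum>\<gamma>\<in>T N. k \<gamma> * \<phi> \<gamma>) = \<phi> 0 + (\<Sum>n<N. of_real (u n) * block_form n (x n) \<phi>)"
    by auto
  have k0: "k 0 = 1"
    using k2[of "\<lambda>\<gamma>. if \<gamma> = 0 then 1 else 0"] finite_T[of N] zero_in_T'[of N]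
    by (simp add: block_form_delta if_distrib[of "\<lambda>z. _ * z"] sum.delta cong: if_cong)
  \<comment> \<open>The three frequencies are indexed by \<open>0\<close>, \<open>1\<close>,
    \<open>2\<close> instead of by their values: \<open>\<theta> N\<close> and
    \<open>- \<theta> N\<close> may coincide, and then both weights must count.\<close>
  define wt where "wt = (\<lambda>e::nat. if e = 0 then 0 else if e = 1 then \<theta> N else - \<theta> N)"
  define I where "I = T N \<times> (B N \<times> B N) \<times> {0, 1, 2::nat}"
  define w where "w = (\<lambda>(\<gamma>, (b, b'), e). \<gamma> + (b' - b) + wt e)"
  define a where "a = (\<lambda>(\<gamma>, (b, b'), e::nat). k \<gamma> * (x N (b' - b) / of_nat (card (B N))) * (if e = 0 then 1 else of_real (u N) / 2))"
  have fin: "finite I" using finite_T finite_B by (simp add: I_def)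
  have "w ` I \<subseteq> T (Suc N)"
    unfolding I_def w_def wt_def using difference_set_mem[of _ "B N"] by (auto intro!: T_step)
  then obtain k' where k': "\<And>\<psi>. (\<Sum>\<gamma>\<in>T (Suc N). k' \<gamma> * \<psi> \<gamma>) = (\<Sum>i\<in>I. a i * \<psi> (w i))"
    using collect_coefficients[OF fin finite_T[of "Suc N"], of w a] by metis
  have k'_eq: "(\<Sum>\<gamma>\<in>T (Suc N). k' \<gamma> * \<psi> \<gamma>) = (\<Sum>\<gamma>\<in>T N. k \<gamma> *
     (\<Sum>(b, b')\<in>B N \<times> B N. x N (b' - b) / of_nat (card (B N)) *
       (\<psi> (\<gamma> + (b' - b)) + of_real (u N) / 2 * \<psi> (\<gamma> + (b' - b + \<theta> N)) + of_real (u N) / 2 * \<psi> (\<gamma> + (b' - b - \<theta> N)))))" for \<psi>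
    unfolding k' I_def sum.cartesian_product' sum_distrib_left
    by (intro sum.cong refl) (simp add: a_def w_def wt_def algebra_simps)
  show ?case
  proof (intro exI[of _ k'] conjI ballI allI impI)
    fix \<xi> :: "'a \<Rightarrow> complex" assume \<xi>: "\<xi> \<in> dual_group"
    have "complex_of_real (\<Prod>n<Suc N. factor n (u n) (x n) \<xi>)
        = (\<Sum>\<gamma>\<in>T N. k \<gamma> * cnj (\<xi> \<gamma>)) * complex_of_real (factor N (u N) (x N) \<xi>)"
      using k[OF \<xi>] by simp
    also have "\<dots> = (\<Sum>\<gamma>\<in>T (Suc N). k' \<gamma> * cnj (\<xi> \<gamma>))"
      unfolding k'_eq factor_eq[OF x \<xi>] sum_distrib_right mult.assoc
      unfolding sum_distrib_left[of "cnj _"]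
      by (intro sum.cong refl arg_cong2[where f = "(*)"])
        (auto simp: dual_groupD(2)[OF \<xi>, of _ "_ - _"] dual_groupD(2)[OF \<xi>, of _ "_ + _"] distrib_left mult.left_commute)
    finally show "complex_of_real (\<Prod>n<Suc N. factor n (u n) (x n) \<xi>) = (\<Sum>\<gamma>\<in>T (Suc N). k' \<gamma> * cnj (\<xi> \<gamma>))" .
  next
    fix \<phi> :: "'a \<Rightarrow> complex" assume \<phi>: "\<forall>\<gamma>. \<gamma> \<notin> insert 0 E \<longrightarrow> \<phi> \<gamma> = 0"
    have "(\<Sum>\<gamma>\<in>T (Suc N). k' \<gamma> * \<phi> \<gamma>) = (\<Sum>\<gamma>\<in>T N. k \<gamma> * (\<phi> \<gamma> + (if \<gamma> = 0 then of_real (u N) * block_form N (x N) \<phi> else 0)))"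
      unfolding k'_eq using \<phi> by (intro sum.cong refl arg_cong2[where f = "(*)"] factor_action x) auto
    also have "\<dots> = (\<Sum>\<gamma>\<in>T N. k \<gamma> * \<phi> \<gamma>) + of_real (u N) * block_form N (x N) \<phi>"
      using finite_T[of N] zero_in_T'[of N]
      by (simp add: distrib_left sum.distrib if_distrib[of "\<lambda>z. _ * z"] sum.delta k0 cong: if_cong)
    finally show "(\<Sum>\<gamma>\<in>T (Suc N). k' \<gamma> * \<phi> \<gamma>) = \<phi> 0 + (\<Sum>n<Suc N. of_real (u n) * block_form n (x n) \<phi>)"
      using k2[of \<phi>] \<phi> by simp
  qed
qed

end

section \<open>Bounds for integrals of bounded functions\<close>

context haar begin

lemma fourier_one: "fourier \<mu> (\<lambda>_. 1) \<gamma> = (if \<gamma> = 0 then 1 else 0)"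
proof -
  have "fourier \<mu> (\<lambda>_. 1) \<gamma> = fourier \<mu> (\<lambda>\<xi>. \<xi> 0) \<gamma>"
    unfolding fourier_def by (rule Bochner_Integration.integral_cong) (auto simp: space_haar dual_groupD)
  then show ?thesis by (auto simp: fourier_character)
qed

lemma ess_bound_nonneg:
  assumes "AE \<xi> in \<mu>. norm (f \<xi>) \<le> M"
  shows "0 \<le> (M :: real)"
proof -
  have "AE \<xi> in \<mu>. 0 \<le> M"
    using assms by eventually_elim (use norm_ge_zero order_trans in blast)
  then show ?thesis by simp
qed

lemma norm_integral_le:
  fixes f :: "('a \<Rightarrow> complex) \<Rightarrow> complex"
  assumes f: "f \<in> borel_measurable \<mu>" "AE \<xi> in \<mu>. norm (f \<xi>) \<le> M" and K: "continuous_on dual_group K"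
  shows "norm (LINT \<xi>|\<mu>. f \<xi> * K \<xi>) \<le> M * (LINT \<xi>|\<mu>. norm (K \<xi>))"
proof -
  have "norm (LINT \<xi>|\<mu>. f \<xi> * K \<xi>) \<le> (LINT \<xi>|\<mu>. norm (f \<xi> * K \<xi>))"
    by (rule integral_norm_bound)
  also have "\<dots> \<le> (LINT \<xi>|\<mu>. M * norm (K \<xi>))"
  proof (rule integral_mono_AE)
    show "integrable \<mu> (\<lambda>\<xi>. norm (f \<xi> * K \<xi>))"
      by (intro integrable_norm integrable_ess_bounded_mult[OF f K])
    show "integrable \<mu> (\<lambda>\<xi>. M * norm (K \<xi>))"
      by (intro integrable_mult_right integrable_continuous continuous_on_norm K)
    show "AE \<xi> in \<mu>. norm (f \<xi> * K \<xi>) \<le> M * norm (K \<xi>)"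
      using f(2) by eventually_elim (simp add: norm_mult mult_right_mono)
  qed
  finally show ?thesis by simp
qed

lemma norm_fourier_le:
  assumes f: "f \<in> borel_measurable \<mu>" "AE \<xi> in \<mu>. norm (f \<xi>) \<le> M"
  shows "norm (fourier \<mu> f \<gamma>) \<le> M"
proof -
  have "norm (fourier \<mu> f \<gamma>) \<le> M * (LINT \<xi>|\<mu>. norm (cnj (\<xi> \<gamma>)))"
    unfolding fourier_def by (intro norm_integral_le f continuous_on_cnj continuous_on_eval)
  also have "(LINT \<xi>|\<mu>. norm (cnj (\<xi> \<gamma>))) = (LINT \<xi>|\<mu>. 1)"
    by (rule Bochner_Integration.integral_cong) (auto simp: space_haar dual_groupD)
  finally show ?thesis by (simp add: prob_space)
qed

end

section \<open>The Rosenthal property\<close>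

locale haar_block_system = haar \<mu> + block_system A B C T \<theta>
  for \<mu> :: "('a::ab_group_add \<Rightarrow> complex) measure" and A B C T :: "nat \<Rightarrow> 'a set" and \<theta>
begin

text \<open>The factor \<open>\<xi> (\<theta> n)\<close> is left out. It has modulus one on the
  dual, so it does not affect the norm, and it is restored in the partial sums.\<close>

definition block_poly :: "('a \<Rightarrow> complex) \<Rightarrow> nat \<Rightarrow> ('a \<Rightarrow> complex) \<Rightarrow> complex" where
  "block_poly \<phi> n \<xi> = (\<Sum>c\<in>C n. \<phi> (\<theta> n + c) * \<xi> c)"

lemma continuous_on_block_poly: "continuous_on S (block_poly \<phi> n)"
  unfolding block_poly_def[abs_def]
  by (intro continuous_on_sum continuous_on_mult continuous_on_const continuous_on_eval)

lemma continuous_on_factor: "continuous_on S (factor n u x)"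
  unfolding factor_def[abs_def]
  by (intro continuous_on_mult continuous_on_divide continuous_on_power continuous_on_norm continuous_on_add
      continuous_on_sum continuous_on_const continuous_on_Re continuous_on_eval)
    (use finite_B[of n] B_nonempty[of n] in auto)

context
  fixes f :: "('a \<Rightarrow> complex) \<Rightarrow> complex" and M :: real
  assumes f: "f \<in> borel_measurable \<mu>" "AE \<xi> in \<mu>. norm (f \<xi>) \<le> M"
    and f_E: "\<And>\<gamma>. \<gamma> \<notin> E \<Longrightarrow> fourier \<mu> f \<gamma> = 0"
begin

text \<open>By \<open>kernel_expansion\<close> the signed sum is the integral of \<open>f\<close>
  against the kernel; the term at frequency \<open>0\<close> vanishes since \<open>0\<close> is not
  in \<open>E\<close>. The kernel is nonnegative with integral \<open>1\<close>, so this integral is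
  at most \<open>M\<close> in modulus.\<close>

lemma signed_block_forms_le:
  assumes x: "\<And>n. x n \<in> dual_group" and u: "\<And>n. \<bar>u n\<bar> \<le> 1"
  shows "norm (\<Sum>n<N. of_real (u n) * block_form n (x n) (fourier \<mu> f)) \<le> M"
proof -
  define K where "K \<xi> = (\<Prod>n<N. factor n (u n) (x n) \<xi>)" for \<xi>
  obtain k where k: "\<And>\<xi>. \<xi>\<in>dual_group \<Longrightarrow> complex_of_real (K \<xi>) = (\<Sum>\<gamma>\<in>T N. k \<gamma> * cnj (\<xi> \<gamma>))"
    and k2: "\<And>\<phi>. (\<And>\<gamma>. \<gamma> \<notin> insert 0 E \<Longrightarrow> \<phi> \<gamma> = 0) \<Longrightarrow>
      (\<Sum>\<gamma>\<in>T N. k \<gamma> * \<phi> \<gamma>) = \<phi> 0 + (\<Sum>n<N. of_real (u n) * block_form n (x n) \<phi>)"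
    using kernel_expansion[where x = x and N = N and u = u, OF x] unfolding K_def by auto
  have Kc: "continuous_on dual_group K"
    unfolding K_def by (intro continuous_on_prod continuous_on_factor)
  then have Kc': "continuous_on dual_group (\<lambda>\<xi>. complex_of_real (K \<xi>))"
    by (rule continuous_on_of_real)
  have K0: "0 \<le> K \<xi>" if "\<xi> \<in> dual_group" for \<xi>
    unfolding K_def using that factor_nonneg u by (intro prod_nonneg) auto
  have "(LINT \<xi>|\<mu>. 1 * complex_of_real (K \<xi>)) = (\<Sum>\<gamma>\<in>T N. k \<gamma> * fourier \<mu> (\<lambda>_. 1) \<gamma>)"
    by (rule integral_ess_bounded_family[where B = 1]) (auto simp: k)
  also have "\<dots> = 1"
    unfolding fourier_one by (subst k2) (auto simp: block_form_delta)
  finally have "complex_of_real (LINT \<xi>|\<mu>. K \<xi>) = 1" by simp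
  then have K1: "(LINT \<xi>|\<mu>. K \<xi>) = 1" by simp
  have "(\<Sum>n<N. of_real (u n) * block_form n (x n) (fourier \<mu> f)) = (\<Sum>\<gamma>\<in>T N. k \<gamma> * fourier \<mu> f \<gamma>)"
    using f_E zero_notin_E by (subst k2) auto
  also have "\<dots> = (LINT \<xi>|\<mu>. f \<xi> * complex_of_real (K \<xi>))"
    by (rule integral_ess_bounded_family[symmetric, OF f]) (auto simp: k)
  also have "norm \<dots> \<le> M * (LINT \<xi>|\<mu>. norm (complex_of_real (K \<xi>)))"
    by (intro norm_integral_le f Kc')
  also have "(LINT \<xi>|\<mu>. norm (complex_of_real (K \<xi>))) = (LINT \<xi>|\<mu>. K \<xi>)"
    by (rule Bochner_Integration.integral_cong) (auto simp: space_haar K0)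
  finally show ?thesis by (simp add: K1)
qed

text \<open>The signs are real, so real and imaginary parts are treated by two separate choices of
  signs; hence the factor \<open>2\<close>.\<close>

lemma block_forms_le:
  assumes x: "\<And>n. x n \<in> dual_group"
  shows "(\<Sum>n<N. norm (block_form n (x n) (fourier \<mu> f))) \<le> 2 * M"
proof -
  let ?a = "\<lambda>n. block_form n (x n) (fourier \<mu> f)"
  define u v where "u n = (if Re (?a n) \<ge> 0 then 1 else - 1 :: real)"
    and "v n = (if Im (?a n) \<ge> 0 then 1 else - 1 :: real)" for n
  have "(\<Sum>n<N. norm (?a n)) \<le> (\<Sum>n<N. \<bar>Re (?a n)\<bar> + \<bar>Im (?a n)\<bar>)"
    by (intro sum_mono cmod_le)
  also have "\<dots> = (\<Sum>n<N. Re (of_real (u n) * ?a n)) + (\<Sum>n<N. Im (of_real (v n) * ?a n))"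
    unfolding sum.distrib[symmetric] by (intro sum.cong refl) (auto simp: u_def v_def)
  also have "\<dots> = Re (\<Sum>n<N. of_real (u n) * ?a n) + Im (\<Sum>n<N. of_real (v n) * ?a n)"
    by simp
  also have "\<dots> \<le> norm (\<Sum>n<N. of_real (u n) * ?a n) + norm (\<Sum>n<N. of_real (v n) * ?a n)"
    by (intro add_mono complex_Re_le_cmod order_trans[OF abs_ge_self abs_Im_le_cmod])
  also have "\<dots> \<le> M + M"
    by (intro add_mono signed_block_forms_le x) (auto simp: u_def v_def)
  finally show ?thesis by simp
qed

text \<open>Grouping the pairs by their difference turns the form into a Fejer sum; differences
  outside \<open>C n\<close> drop out by \<open>shifted_diff_in_E\<close>.\<close>

lemma block_form_eq:
  "block_form n x (fourier \<mu> f) = of_real (\<kappa> n) *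
    (\<Sum>c\<in>C n. of_real (diff_count (B n) c / card (B n)) * (fourier \<mu> f (\<theta> n + c) * x c))"
proof -
  let ?g = "\<lambda>v. x v / of_nat (card (B n)) * fourier \<mu> f (\<theta> n + v)"
  have fin: "finite (B n \<times> B n)" using finite_B by simp
  have "(\<Sum>(b, b')\<in>B n \<times> B n. ?g (b' - b)) = (\<Sum>p\<in>B n \<times> B n. ?g ((\<lambda>(b, b'). b' - b) p))"
    by (simp add: case_prod_unfold)
  also have "\<dots> = (\<Sum>v\<in>difference_set (B n). \<Sum>p\<in>{p\<in>B n \<times> B n. (\<lambda>(b, b'). b' - b) p = v}. ?g ((\<lambda>(b, b'). b' - b) p))"
    unfolding difference_set_def by (rule sum.image_gen[OF fin])
  also have "\<dots> = (\<Sum>v\<in>difference_set (B n). of_nat (diff_count (B n) v) * ?g v)"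
  proof (intro sum.cong refl)
    fix v
    have "(\<Sum>p\<in>{p\<in>B n \<times> B n. (\<lambda>(b, b'). b' - b) p = v}. ?g ((\<lambda>(b, b'). b' - b) p))
        = (\<Sum>p\<in>{(b, b') \<in> B n \<times> B n. b' - b = v}. ?g v)"
      by (rule sum.cong) auto
    then show "(\<Sum>p\<in>{p\<in>B n \<times> B n. (\<lambda>(b, b'). b' - b) p = v}. ?g ((\<lambda>(b, b'). b' - b) p)) = of_nat (diff_count (B n) v) * ?g v"
      unfolding diff_count_def by simp
  qed
  also have "\<dots> = (\<Sum>v\<in>C n. of_nat (diff_count (B n) v) * ?g v)"
    using shifted_diff_in_E f_E C_subset finite_B
    by (intro sum.mono_neutral_right) (auto simp: difference_set_def)
  finally show ?thesis
    unfolding block_form_def by (simp add: algebra_simps)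
qed

text \<open>Replacing the Fejer weights by \<open>1\<close> costs at most
  \<open>M * (1 / 2) ^ n\<close> by \<open>almost_invariant\<close>; the factor \<open>2\<close>
  undoes \<open>\<kappa> n\<close>, which is at least \<open>1 / 2\<close>.\<close>

lemma block_poly_le:
  assumes x: "x \<in> dual_group"
  shows "norm (block_poly (fourier \<mu> f) n x) \<le> 2 * norm (block_form n x (fourier \<mu> f)) + M * (1 / 2) ^ n"
proof -
  let ?r = "\<lambda>c. diff_count (B n) c / card (B n)"
  let ?S = "\<Sum>c\<in>C n. of_real (?r c) * (fourier \<mu> f (\<theta> n + c) * x c)"
  have "0 < card (B n)" using finite_B B_nonempty by (simp add: card_gt_0_iff)
  then have r: "?r c \<le> 1" for c using diff_count_le[OF finite_B, of n c] by simp
  have "norm (block_poly (fourier \<mu> f) n x - ?S) = norm (\<Sum>c\<in>C n. of_real (1 - ?r c) * (fourier \<mu> f (\<theta> n + c) * x c))"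
    unfolding block_poly_def sum_subtractf[symmetric] by (simp add: algebra_simps)
  also have "\<dots> \<le> (\<Sum>c\<in>C n. (1 - ?r c) * M)"
  proof (rule sum_norm_le)
    fix c
    have "norm (of_real (1 - ?r c) * (fourier \<mu> f (\<theta> n + c) * x c)) = (1 - ?r c) * norm (fourier \<mu> f (\<theta> n + c))"
      unfolding norm_mult norm_of_real dual_groupD(1)[OF x] using r[of c] by simp
    then show "norm (of_real (1 - ?r c) * (fourier \<mu> f (\<theta> n + c) * x c)) \<le> (1 - ?r c) * M"
      using r[of c] norm_fourier_le[OF f] by (simp add: mult_left_mono)
  qed
  also have "\<dots> = (\<Sum>c\<in>C n. 1 - ?r c) * M" by (simp add: sum_distrib_right)
  also have "\<dots> \<le> (1 / 2) ^ n * M"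
    by (intro mult_right_mono almost_invariant ess_bound_nonneg[OF f(2)])
  finally have "norm (block_poly (fourier \<mu> f) n x - ?S) \<le> M * (1 / 2) ^ n" by (simp add: mult.commute)
  moreover have "norm ?S \<le> 2 * norm (block_form n x (fourier \<mu> f))"
    unfolding block_form_eq norm_mult by (simp add: \<kappa>_def)
  moreover have "norm (block_poly (fourier \<mu> f) n x) \<le> norm (block_poly (fourier \<mu> f) n x - ?S) + norm ?S"
    using norm_triangle_sub[of "block_poly (fourier \<mu> f) n x" ?S] by (simp only: add.commute)
  ultimately show ?thesis by simp
qed

text \<open>The two contributions are \<open>4 * M\<close> from \<open>block_forms_le\<close> and
  \<open>2 * M\<close> from the geometric series.\<close>

lemma block_polys_le:
  assumes x: "\<And>n. x n \<in> dual_group"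
  shows "(\<Sum>n<N. norm (block_poly (fourier \<mu> f) n (x n))) \<le> 6 * M"
proof -
  have "(\<Sum>n<N. norm (block_poly (fourier \<mu> f) n (x n)))
      \<le> (\<Sum>n<N. 2 * norm (block_form n (x n) (fourier \<mu> f)) + M * (1 / 2) ^ n)"
    by (intro sum_mono block_poly_le x)
  also have "\<dots> = 2 * (\<Sum>n<N. norm (block_form n (x n) (fourier \<mu> f))) + M * (\<Sum>n<N. (1 / 2) ^ n)"
    by (simp add: sum.distrib sum_distrib_left)
  also have "(\<Sum>n<N. (1 / 2 :: real) ^ n) \<le> 2"
    by (subst sum_gp_strict) simp
  then have "M * (\<Sum>n<N. (1 / 2) ^ n) \<le> M * 2" using ess_bound_nonneg[OF f(2)] by (rule mult_left_mono)
  then have "2 * (\<Sum>n<N. norm (block_form n (x n) (fourier \<mu> f))) + M * (\<Sum>n<N. (1 / 2) ^ n) \<le> 2 * (2 * M) + M * 2"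
    using block_forms_le[where x = x and N = N, OF x] by simp
  finally show ?thesis by simp
qed

lemma blocks_disjoint:
  assumes "c \<in> C m" "c' \<in> C n" "\<theta> m + c = \<theta> n + c'"
  shows "m = n"
proof (rule ccontr)
  assume "m \<noteq> n"
  then consider "m < n" | "n < m" by linarith
  then show False
  proof cases
    case 1
    then show False using T_not_later_block[OF 1 block_in_T[OF lessI assms(1)] assms(2)] assms(3) by simp
  next
    case 2
    then show False using T_not_later_block[OF 2 block_in_T[OF lessI assms(2)] assms(1)] assms(3) by simp
  qed
qed

lemma fourier_partial_sum:
  "fourier \<mu> (\<lambda>\<xi>. \<Sum>n<N. \<xi> (\<theta> n) * block_poly (fourier \<mu> f) n \<xi>) \<gamma> =
    (\<Sum>n<N. \<Sum>c\<in>C n. if \<theta> n + c = \<gamma> then fourier \<mu> f \<gamma> else 0)"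
proof -
  have "fourier \<mu> (\<lambda>\<xi>. \<Sum>n<N. \<xi> (\<theta> n) * block_poly (fourier \<mu> f) n \<xi>) \<gamma>
      = (LINT \<xi>|\<mu>. (\<Sum>n<N. \<Sum>c\<in>C n. fourier \<mu> f (\<theta> n + c) * (\<xi> (\<theta> n + c) * cnj (\<xi> \<gamma>))))"
    unfolding fourier_def[of \<mu> "\<lambda>\<xi>. \<Sum>n<N. \<xi> (\<theta> n) * block_poly (fourier \<mu> f) n \<xi>"]
    by (rule Bochner_Integration.integral_cong)
      (auto simp: space_haar dual_groupD(2) block_poly_def sum_distrib_left sum_distrib_right ac_simps)
  also have "\<dots> = (\<Sum>n<N. \<Sum>c\<in>C n. fourier \<mu> f (\<theta> n + c) * fourier \<mu> (\<lambda>\<xi>. \<xi> (\<theta> n + c)) \<gamma>)"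
  proof -
    have int: "integrable \<mu> (\<lambda>\<xi>. a * (\<xi> \<delta> * cnj (\<xi> \<gamma>)))" for a \<delta>
      by (intro integrable_continuous continuous_on_mult continuous_on_const continuous_on_eval continuous_on_cnj)
    show ?thesis
      unfolding fourier_def[of \<mu> "\<lambda>\<xi>. \<xi> (\<theta> _ + _)"]
      by (subst Bochner_Integration.integral_sum, intro Bochner_Integration.integrable_sum int,
          intro sum.cong refl, subst Bochner_Integration.integral_sum, rule int) simp
  qed
  also have "\<dots> = (\<Sum>n<N. \<Sum>c\<in>C n. if \<theta> n + c = \<gamma> then fourier \<mu> f \<gamma> else 0)"
    by (intro sum.cong refl) (simp add: fourier_character)
  finally show ?thesis .
qed

text \<open>The blocks are disjoint, so each frequency of \<open>E\<close> is served by exactly one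
  block, and its coefficient is exact once that block is included.\<close>

lemma fourier_partial_sum_eventually:
  "eventually (\<lambda>N. fourier \<mu> (\<lambda>\<xi>. \<Sum>n<N. \<xi> (\<theta> n) * block_poly (fourier \<mu> f) n \<xi>) \<gamma> = fourier \<mu> f \<gamma>) sequentially"
proof (cases "\<gamma> \<in> E")
  case False
  then have "\<theta> n + c \<noteq> \<gamma>" if "c \<in> C n" for n c using that E_iff by blast
  then have "fourier \<mu> (\<lambda>\<xi>. \<Sum>n<N. \<xi> (\<theta> n) * block_poly (fourier \<mu> f) n \<xi>) \<gamma> = 0" for N
    unfolding fourier_partial_sum by (intro sum.neutral ballI) simp
  then show ?thesis using f_E[OF False] by simp
next
  case True
  then obtain m c where mc: "c \<in> C m" "\<gamma> = \<theta> m + c" by (auto simp: E_iff)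
  have "(\<Sum>d\<in>C n. if \<theta> n + d = \<gamma> then fourier \<mu> f \<gamma> else 0) = (if n = m then fourier \<mu> f \<gamma> else 0)" for n
  proof (cases "n = m")
    case True
    have "(\<Sum>d\<in>C m. if \<theta> m + d = \<gamma> then fourier \<mu> f \<gamma> else 0) = (\<Sum>d\<in>C m. if d = c then fourier \<mu> f \<gamma> else 0)"
      by (intro sum.cong refl) (simp add: mc(2))
    then show ?thesis using True mc(1) finite_C[of m] by simp
  next
    case False
    then have "\<theta> n + d \<noteq> \<gamma>" if "d \<in> C n" for d
      using blocks_disjoint[OF that mc(1)] mc(2) by auto
    then show ?thesis using False by (simp add: sum.neutral)
  qed
  then have "fourier \<mu> (\<lambda>\<xi>. \<Sum>n<N. \<xi> (\<theta> n) * block_poly (fourier \<mu> f) n \<xi>) \<gamma> = fourier \<mu> f \<gamma>" if "m < N" for N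
    unfolding fourier_partial_sum using that by simp
  then show ?thesis
    unfolding eventually_sequentially by (intro exI[of _ "Suc m"]) auto
qed

text \<open>The points in \<open>block_polys_le\<close> are arbitrary, so they can be taken where
  the blocks attain their maximum modulus. These maxima are therefore summable, the blocked series
  converges uniformly to a continuous \<open>g\<close>, and \<open>fourier_unique\<close> identifies
  \<open>f\<close> with \<open>g\<close>.\<close>

lemma ae_eq_continuous: "\<exists>g\<in>C_space \<mu> E. AE \<xi> in \<mu>. f \<xi> = g \<xi>"
proof -
  define P where "P n \<xi> = \<xi> (\<theta> n) * block_poly (fourier \<mu> f) n \<xi>" for n \<xi>
  have Pc: "continuous_on dual_group (P n)" for n
    unfolding P_def[abs_def] by (intro continuous_on_mult continuous_on_eval continuous_on_block_poly)
  have "\<exists>x\<in>dual_group. \<forall>y\<in>dual_group. norm (block_poly (fourier \<mu> f) n y) \<le> norm (block_poly (fourier \<mu> f) n x)" for n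
    using one_in_dual_group
    by (intro continuous_attains_sup compact_dual_group continuous_on_norm continuous_on_block_poly) blast
  then obtain x where x: "\<And>n. x n \<in> dual_group"
    and max: "\<And>n y. y \<in> dual_group \<Longrightarrow> norm (block_poly (fourier \<mu> f) n y) \<le> norm (block_poly (fourier \<mu> f) n (x n))"
    by metis
  define m where "m n = norm (block_poly (fourier \<mu> f) n (x n))" for n
  have "(\<Sum>n\<le>N. m n) \<le> 6 * M" for N
    using block_polys_le[where x = x and N = "Suc N", OF x] by (simp only: m_def lessThan_Suc_atMost)
  then have sm: "summable m"
    by (intro bounded_imp_summable) (auto simp: m_def)
  have Pm: "norm (P n \<xi>) \<le> m n" if "\<xi> \<in> dual_group" for n \<xi>
    using max[OF that] by (simp add: P_def m_def norm_mult dual_groupD(1)[OF that])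
  define g where "g \<xi> = (\<Sum>n. P n \<xi>)" for \<xi>
  have ul: "uniform_limit dual_group (\<lambda>n \<xi>. \<Sum>i<n. P i \<xi>) g sequentially"
    unfolding g_def by (rule Weierstrass_m_test[OF Pm sm])
  have gc: "continuous_on dual_group g"
    by (rule uniform_limit_theorem[OF _ ul]) (auto intro!: always_eventually continuous_on_sum Pc)
  have Sbound: "norm (\<Sum>i<N. P i \<xi>) \<le> suminf m" if "\<xi> \<in> dual_group" for N \<xi>
  proof -
    have "norm (\<Sum>i<N. P i \<xi>) \<le> (\<Sum>i<N. m i)" by (intro sum_norm_le Pm that)
    also have "\<dots> \<le> suminf m" by (intro sum_le_suminf sm) (auto simp: m_def)
    finally show ?thesis .
  qed
  have lim: "(\<lambda>N. \<Sum>i<N. P i \<xi>) \<longlonglongrightarrow> g \<xi>" if "\<xi> \<in> dual_group" for \<xi>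
    using tendsto_uniform_limitI[OF ul that] .
  have gb: "norm (g \<xi>) \<le> suminf m" if "\<xi> \<in> dual_group" for \<xi>
    using lim[OF that] Sbound[OF that] by (intro Lim_bounded[OF tendsto_norm]) auto
  have gF: "fourier \<mu> g \<gamma> = fourier \<mu> f \<gamma>" for \<gamma>
  proof -
    have "(\<lambda>N. LINT \<xi>|\<mu>. (\<Sum>i<N. P i \<xi>) * cnj (\<xi> \<gamma>)) \<longlonglongrightarrow> (LINT \<xi>|\<mu>. g \<xi> * cnj (\<xi> \<gamma>))"
    proof (rule integral_dominated_convergence[where w = "\<lambda>_. suminf m"])
      show "(\<lambda>\<xi>. g \<xi> * cnj (\<xi> \<gamma>)) \<in> borel_measurable \<mu>"
        "(\<lambda>\<xi>. (\<Sum>i<N. P i \<xi>) * cnj (\<xi> \<gamma>)) \<in> borel_measurable \<mu>" for N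
        by (intro measurable_continuous continuous_on_mult gc continuous_on_cnj continuous_on_eval continuous_on_sum Pc)+
      show "AE \<xi> in \<mu>. (\<lambda>N. (\<Sum>i<N. P i \<xi>) * cnj (\<xi> \<gamma>)) \<longlonglongrightarrow> g \<xi> * cnj (\<xi> \<gamma>)"
        by (intro AE_I2 tendsto_mult lim tendsto_const) (simp add: space_haar)
      show "AE \<xi> in \<mu>. norm ((\<Sum>i<N. P i \<xi>) * cnj (\<xi> \<gamma>)) \<le> suminf m" for N
        using Sbound by (intro AE_I2) (simp add: space_haar norm_mult dual_groupD(1))
    qed simp
    then have "(\<lambda>N. fourier \<mu> (\<lambda>\<xi>. \<Sum>i<N. P i \<xi>) \<gamma>) \<longlonglongrightarrow> fourier \<mu> g \<gamma>"
      by (simp only: fourier_def)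
    moreover have "(\<lambda>N. fourier \<mu> (\<lambda>\<xi>. \<Sum>i<N. P i \<xi>) \<gamma>) \<longlonglongrightarrow> fourier \<mu> f \<gamma>"
      using fourier_partial_sum_eventually[of \<gamma>] unfolding P_def by (rule tendsto_eventually)
    ultimately show ?thesis by (rule LIMSEQ_unique)
  qed
  have "AE \<xi> in \<mu>. f \<xi> - g \<xi> = 0"
  proof (rule fourier_unique)
    show "(\<lambda>\<xi>. f \<xi> - g \<xi>) \<in> borel_measurable \<mu>"
      using f(1) measurable_continuous[OF gc] by simp
    show "AE \<xi> in \<mu>. norm (f \<xi> - g \<xi>) \<le> M + suminf m"
      using f(2) AE_space
    proof eventually_elim
      fix \<xi> assume "norm (f \<xi>) \<le> M" "\<xi> \<in> space \<mu>"
      then show "norm (f \<xi> - g \<xi>) \<le> M + suminf m"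
        using gb[of \<xi>] norm_triangle_ineq4[of "f \<xi>" "g \<xi>"] by (simp add: space_haar)
    qed
    fix \<gamma>
    have "integrable \<mu> (\<lambda>\<xi>. f \<xi> * cnj (\<xi> \<gamma>))" "integrable \<mu> (\<lambda>\<xi>. g \<xi> * cnj (\<xi> \<gamma>))"
      by (intro integrable_ess_bounded_mult[OF f] integrable_continuous continuous_on_mult gc continuous_on_cnj continuous_on_eval)+
    then have "fourier \<mu> (\<lambda>\<xi>. f \<xi> - g \<xi>) \<gamma> = fourier \<mu> f \<gamma> - fourier \<mu> g \<gamma>"
      unfolding fourier_def by (simp add: left_diff_distrib)
    then show "fourier \<mu> (\<lambda>\<xi>. f \<xi> - g \<xi>) \<gamma> = 0" by (simp add: gF)
  qed
  moreover have "g \<in> C_space \<mu> E"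
    using gc gF f_E by (simp add: C_space_def)
  ultimately show ?thesis by auto
qed

end

lemma rosenthal_E: "rosenthal_set \<mu> E"
  unfolding rosenthal_set_def L_infinity_def using ae_eq_continuous by blast

end

section \<open>Moments of sums of characters over sets of small doubling\<close>

text \<open>Values below \<open>N / 2\<close> satisfy
  \<open>x ^ 4 \<le> (N / 2) ^ 2 * x ^ 2\<close>; for the others \<open>x powr t\<close> is at least
  \<open>(N / 2) powr t\<close>, while \<open>x ^ 4\<close> is at most \<open>N ^ 4\<close>.\<close>

lemma fourth_power_truncation:
  fixes x N t :: real
  assumes "0 \<le> x" "x \<le> N" "0 < N" "0 < t"
  shows "x ^ 4 \<le> N\<^sup>2 / 4 * x ^ 2 + N ^ 4 / (N / 2) powr t * x powr t"
proof (cases "x < N / 2")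
  case True
  then have "x ^ 2 \<le> (N / 2) ^ 2" using assms by (intro power_mono) auto
  then have "x ^ 2 \<le> N ^ 2 / 4" by (simp add: power_divide)
  then have "x ^ 2 * x ^ 2 \<le> N ^ 2 / 4 * x ^ 2" by (rule mult_right_mono) simp
  moreover have "x ^ 4 = x ^ 2 * x ^ 2" by (simp flip: power_add)
  moreover have "0 \<le> N ^ 4 / (N / 2) powr t * x powr t" by simp
  ultimately show ?thesis by linarith
next
  case False
  then have "(N / 2) powr t \<le> x powr t" using assms by (intro powr_mono2) auto
  then have "1 \<le> x powr t / (N / 2) powr t" using assms by (simp add: divide_simps)
  then have "N ^ 4 * 1 \<le> N ^ 4 * (x powr t / (N / 2) powr t)" by (rule mult_left_mono) simp
  moreover have "x ^ 4 \<le> N ^ 4" using assms by (intro power_mono) auto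
  moreover have "0 \<le> N\<^sup>2 / 4 * x ^ 2" by simp
  moreover have "N ^ 4 * (x powr t / (N / 2) powr t) = N ^ 4 / (N / 2) powr t * x powr t" by simp
  ultimately show ?thesis by linarith
qed

context haar begin

lemma parseval_finite:
  assumes "finite S"
  shows "(LINT \<xi>|\<mu>. (norm (\<Sum>\<gamma>\<in>S. of_real (r \<gamma>) * \<xi> \<gamma>))\<^sup>2) = (\<Sum>\<gamma>\<in>S. (r \<gamma>)\<^sup>2)"
proof -
  have int: "integrable \<mu> (\<lambda>\<xi>. a * (\<xi> \<delta> * cnj (\<xi> \<gamma>)))" for a \<delta> \<gamma>
    by (intro integrable_continuous continuous_on_mult continuous_on_const continuous_on_eval continuous_on_cnj)
  have "complex_of_real (LINT \<xi>|\<mu>. (norm (\<Sum>\<gamma>\<in>S. of_real (r \<gamma>) * \<xi> \<gamma>))\<^sup>2)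
      = (LINT \<xi>|\<mu>. complex_of_real ((norm (\<Sum>\<gamma>\<in>S. of_real (r \<gamma>) * \<xi> \<gamma>))\<^sup>2))"
    by (rule integral_complex_of_real[symmetric])
  also have "\<dots> = (LINT \<xi>|\<mu>. (\<Sum>\<gamma>\<in>S. \<Sum>\<delta>\<in>S. complex_of_real (r \<gamma> * r \<delta>) * (\<xi> \<gamma> * cnj (\<xi> \<delta>))))"
    by (rule Bochner_Integration.integral_cong)
      (simp_all only: complex_norm_square cnj_sum complex_cnj_mult complex_cnj_complex_of_real sum_product of_real_mult ac_simps)
  also have "\<dots> = (\<Sum>\<gamma>\<in>S. \<Sum>\<delta>\<in>S. complex_of_real (r \<gamma> * r \<delta>) * fourier \<mu> (\<lambda>\<xi>. \<xi> \<gamma>) \<delta>)"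
    unfolding fourier_def
    by (subst Bochner_Integration.integral_sum, intro Bochner_Integration.integrable_sum int,
        intro sum.cong refl, subst Bochner_Integration.integral_sum, rule int) simp
  also have "\<dots> = (\<Sum>\<gamma>\<in>S. \<Sum>\<delta>\<in>S. if \<gamma> = \<delta> then complex_of_real ((r \<gamma>)\<^sup>2) else 0)"
    by (intro sum.cong refl) (simp add: fourier_character power2_eq_square)
  also have "\<dots> = complex_of_real (\<Sum>\<gamma>\<in>S. (r \<gamma>)\<^sup>2)"
    using assms by simp
  finally show ?thesis using of_real_eq_iff by blast
qed

lemma second_moment:
  assumes "finite S"
  shows "(LINT \<xi>|\<mu>. (norm (\<Sum>\<gamma>\<in>S. \<xi> \<gamma>))\<^sup>2) = card S"
  using parseval_finite[OF assms, of "\<lambda>_. 1"] by simp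

text \<open>By Cauchy-Schwarz a set of small doubling has large additive energy.\<close>

lemma fourth_moment:
  assumes S: "finite S" "S \<noteq> {}" and doubling: "card ((\<lambda>(a, b). a + b) ` (S \<times> S)) \<le> 2 * card S"
  shows "(LINT \<xi>|\<mu>. (norm (\<Sum>\<gamma>\<in>S. \<xi> \<gamma>)) ^ 4) \<ge> (card S) ^ 3 / 2"
proof -
  define U where "U = (\<lambda>(a, b). a + b) ` (S \<times> S)"
  define r where "r s = real (card {p \<in> S \<times> S. (\<lambda>(a, b). a + b) p = s})" for s
  have finU: "finite U" using S by (simp add: U_def)
  have fin: "finite (S \<times> S)" using S by simp
  \<comment> \<open>Squaring turns the fourth moment into a second moment whose coefficients
    \<open>r s\<close> count the representations of \<open>s\<close> as a sum of two elements of
    \<open>S\<close>.\<close>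
  have sq: "(\<Sum>\<gamma>\<in>S. \<xi> \<gamma>)\<^sup>2 = (\<Sum>s\<in>U. of_real (r s) * \<xi> s)" if \<xi>: "\<xi> \<in> dual_group" for \<xi>
  proof -
    have "(\<Sum>\<gamma>\<in>S. \<xi> \<gamma>)\<^sup>2 = (\<Sum>p\<in>S \<times> S. \<xi> ((\<lambda>(a, b). a + b) p))"
      unfolding power2_eq_square sum_product sum.cartesian_product
      by (intro sum.cong refl) (auto simp: dual_groupD(2)[OF \<xi>])
    also have "\<dots> = (\<Sum>s\<in>U. \<Sum>p\<in>{p \<in> S \<times> S. (\<lambda>(a, b). a + b) p = s}. \<xi> ((\<lambda>(a, b). a + b) p))"
      unfolding U_def by (rule sum.image_gen[OF fin])
    also have "\<dots> = (\<Sum>s\<in>U. \<Sum>p\<in>{p \<in> S \<times> S. (\<lambda>(a, b). a + b) p = s}. \<xi> s)"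
      by (intro sum.cong refl) auto
    finally show ?thesis by (simp add: r_def)
  qed
  have "(LINT \<xi>|\<mu>. (norm (\<Sum>\<gamma>\<in>S. \<xi> \<gamma>)) ^ 4) = (LINT \<xi>|\<mu>. (norm (\<Sum>s\<in>U. of_real (r s) * \<xi> s))\<^sup>2)"
    by (rule Bochner_Integration.integral_cong) (simp_all add: sq[symmetric] space_haar norm_power flip: power_mult)
  also have "\<dots> = (\<Sum>s\<in>U. (r s)\<^sup>2)" by (rule parseval_finite[OF finU])
  finally have int: "(LINT \<xi>|\<mu>. (norm (\<Sum>\<gamma>\<in>S. \<xi> \<gamma>)) ^ 4) = (\<Sum>s\<in>U. (r s)\<^sup>2)" .
  have "(\<Sum>s\<in>U. r s) = (\<Sum>s\<in>U. \<Sum>p\<in>{p \<in> S \<times> S. (\<lambda>(a, b). a + b) p = s}. 1)"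
    by (simp add: r_def)
  also have "\<dots> = (\<Sum>p\<in>S \<times> S. 1)"
    unfolding U_def by (rule sum.image_gen[OF fin, symmetric])
  finally have sum_r: "(\<Sum>s\<in>U. r s) = (card S)\<^sup>2"
    by (simp add: card_cartesian_product power2_eq_square)
  have "(real (card S))\<^sup>2 * (real (card S))\<^sup>2 = (\<Sum>s\<in>U. r s)\<^sup>2" by (simp add: sum_r power2_eq_square)
  also have "\<dots> \<le> (\<Sum>s\<in>U. (r s)\<^sup>2) * card U" by (rule sum_squared_le_sum_of_squares)
  also have "\<dots> \<le> (\<Sum>s\<in>U. (r s)\<^sup>2) * (2 * card S)"
    using doubling by (intro mult_left_mono sum_nonneg) (auto simp: U_def)
  finally have "(real (card S))\<^sup>2 * (real (card S))\<^sup>2 \<le> (\<Sum>s\<in>U. (r s)\<^sup>2) * (2 * card S)" .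
  then have "real (card S) * ((card S) ^ 3 / 2) \<le> real (card S) * (\<Sum>s\<in>U. (r s)\<^sup>2)"
    by (simp add: power2_eq_square power3_eq_cube algebra_simps)
  moreover have "real (card S) > 0" using S by (simp add: card_gt_0_iff)
  ultimately show ?thesis unfolding int by (simp only: mult_le_cancel_left_pos)
qed

context
  fixes S :: "'a set" and N :: real
  assumes S: "finite S" "S \<noteq> {}" and doubling: "card ((\<lambda>(a, b). a + b) ` (S \<times> S)) \<le> 2 * card S"
  defines "N \<equiv> real (card S)"
begin

private lemma N_pos: "0 < N"
  using S by (simp add: N_def card_gt_0_iff)

private lemma sup_bound: "\<xi> \<in> dual_group \<Longrightarrow> norm (\<Sum>\<gamma>\<in>S. \<xi> \<gamma>) \<le> N"
  using sum_norm_le[of S "\<lambda>\<gamma>. \<xi> \<gamma>" "\<lambda>_. 1"] by (simp add: N_def dual_groupD(1))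

private lemma integrable_powr: "0 < t \<Longrightarrow> integrable \<mu> (\<lambda>\<xi>. norm (\<Sum>\<gamma>\<in>S. \<xi> \<gamma>) powr t)"
  by (intro integrable_continuous continuous_on_powr' continuous_on_norm continuous_on_sum continuous_on_eval
      continuous_on_const) auto

private lemma integrable_power: "integrable \<mu> (\<lambda>\<xi>. norm (\<Sum>\<gamma>\<in>S. \<xi> \<gamma>) ^ m)"
  by (intro integrable_continuous continuous_on_power continuous_on_norm continuous_on_sum continuous_on_eval)

text \<open>All but two of the \<open>s\<close> powers are bounded by the maximum \<open>N\<close>;
  the remaining two give the second moment, which is \<open>N\<close>.\<close>

lemma moment_upper:
  assumes "2 \<le> s"
  shows "(LINT \<xi>|\<mu>. norm (\<Sum>\<gamma>\<in>S. \<xi> \<gamma>) powr s) \<le> N powr (s - 1)"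
proof -
  have "(LINT \<xi>|\<mu>. norm (\<Sum>\<gamma>\<in>S. \<xi> \<gamma>) powr s) \<le> (LINT \<xi>|\<mu>. N powr (s - 2) * norm (\<Sum>\<gamma>\<in>S. \<xi> \<gamma>) ^ 2)"
  proof (rule integral_mono)
    show "integrable \<mu> (\<lambda>\<xi>. norm (\<Sum>\<gamma>\<in>S. \<xi> \<gamma>) powr s)" using assms by (intro integrable_powr) simp
    show "integrable \<mu> (\<lambda>\<xi>. N powr (s - 2) * norm (\<Sum>\<gamma>\<in>S. \<xi> \<gamma>) ^ 2)"
      by (intro integrable_mult_right integrable_power)
    fix \<xi> assume "\<xi> \<in> space \<mu>"
    then have X: "norm (\<Sum>\<gamma>\<in>S. \<xi> \<gamma>) \<le> N" using sup_bound by (simp add: space_haar)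
    let ?X = "norm (\<Sum>\<gamma>\<in>S. \<xi> \<gamma>)"
    show "?X powr s \<le> N powr (s - 2) * ?X ^ 2"
    proof (cases "?X = 0")
      case False
      then have "?X powr s = ?X powr (s - 2) * ?X powr 2" using powr_add[of ?X "s - 2" 2] by simp
      also have "?X powr 2 = ?X ^ 2" using False by (simp add: powr_numeral)
      also have "?X powr (s - 2) * ?X ^ 2 \<le> N powr (s - 2) * ?X ^ 2"
        using assms X by (intro mult_right_mono powr_mono2) auto
      finally show ?thesis .
    qed simp
  qed
  also have "\<dots> = N powr (s - 2) * N" using second_moment[OF S(1)] by (simp add: N_def)
  also have "\<dots> = N powr (s - 1)" using powr_add[of N "s - 2" 1] N_pos by simp
  finally show ?thesis .
qed

text \<open>The fourth moment is at least \<open>N ^ 3 / 2\<close>. In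
  \<open>fourth_power_truncation\<close> the quadratic term integrates to \<open>N ^ 3 / 4\<close>,
  so the other term must account for the remaining \<open>N ^ 3 / 4\<close>.\<close>

lemma moment_lower:
  assumes t: "0 < t"
  shows "(LINT \<xi>|\<mu>. norm (\<Sum>\<gamma>\<in>S. \<xi> \<gamma>) powr t) \<ge> (N / 2) powr t / (4 * N)"
proof -
  let ?J = "LINT \<xi>|\<mu>. norm (\<Sum>\<gamma>\<in>S. \<xi> \<gamma>) powr t"
  have "N ^ 3 / 2 \<le> (LINT \<xi>|\<mu>. norm (\<Sum>\<gamma>\<in>S. \<xi> \<gamma>) ^ 4)"
    using fourth_moment[OF S doubling] by (simp add: N_def)
  also have "\<dots> \<le> (LINT \<xi>|\<mu>. N\<^sup>2 / 4 * norm (\<Sum>\<gamma>\<in>S. \<xi> \<gamma>) ^ 2 +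
      N ^ 4 / (N / 2) powr t * norm (\<Sum>\<gamma>\<in>S. \<xi> \<gamma>) powr t)"
  proof (rule integral_mono)
    show "integrable \<mu> (\<lambda>\<xi>. norm (\<Sum>\<gamma>\<in>S. \<xi> \<gamma>) ^ 4)" by (rule integrable_power)
    show "integrable \<mu> (\<lambda>\<xi>. N\<^sup>2 / 4 * norm (\<Sum>\<gamma>\<in>S. \<xi> \<gamma>) ^ 2 +
      N ^ 4 / (N / 2) powr t * norm (\<Sum>\<gamma>\<in>S. \<xi> \<gamma>) powr t)"
      by (intro Bochner_Integration.integrable_add integrable_mult_right integrable_power integrable_powr t)
    fix \<xi> assume "\<xi> \<in> space \<mu>"
    then have X: "norm (\<Sum>\<gamma>\<in>S. \<xi> \<gamma>) \<le> N" using sup_bound by (simp add: space_haar)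
    let ?X = "norm (\<Sum>\<gamma>\<in>S. \<xi> \<gamma>)"
    show "?X ^ 4 \<le> N\<^sup>2 / 4 * ?X ^ 2 + N ^ 4 / (N / 2) powr t * ?X powr t"
      by (rule fourth_power_truncation[OF norm_ge_zero X N_pos t])
  qed
  also have "\<dots> = (LINT \<xi>|\<mu>. N\<^sup>2 / 4 * norm (\<Sum>\<gamma>\<in>S. \<xi> \<gamma>) ^ 2) +
      (LINT \<xi>|\<mu>. N ^ 4 / (N / 2) powr t * norm (\<Sum>\<gamma>\<in>S. \<xi> \<gamma>) powr t)"
    by (intro Bochner_Integration.integral_add integrable_mult_right integrable_power integrable_powr t)
  also have "\<dots> = N\<^sup>2 / 4 * N + N ^ 4 / (N / 2) powr t * ?J"
    using second_moment[OF S(1)] by (simp add: N_def)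
  also have "N\<^sup>2 / 4 * N = N ^ 3 / 4" by (simp add: power2_eq_square power3_eq_cube)
  finally have "N ^ 3 / 4 \<le> N ^ 4 / (N / 2) powr t * ?J" by linarith
  moreover have "N ^ 4 = N ^ 3 * N" by (simp add: eval_nat_numeral)
  ultimately have "N ^ 3 * (1 / 4) \<le> N ^ 3 * (N / (N / 2) powr t * ?J)" by simp
  then have "1 / 4 \<le> N / (N / 2) powr t * ?J"
    using N_pos by (subst (asm) mult_le_cancel_left_pos) auto
  then show ?thesis using N_pos by (simp add: field_simps)
qed

end

end

section \<open>Failure of the Lambda inequalities\<close>

context block_system begin

lemma finite_A: "finite (A n)"
  using card_A[of n] by (metis card.infinite less_nat_zero_code)

lemma A_nonempty: "A n \<noteq> {}"
  using card_A[of n] by auto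

text \<open>The frequencies of the \<open>k\<close>-th power are sums of \<open>k\<close> elements
  of \<open>A n\<close>, which \<open>sums_in_C\<close> places in \<open>C n\<close> as long as
  \<open>k \<le> n\<close>.\<close>

lemma block_power_trig_poly:
  assumes "k \<le> n"
  shows "\<exists>P\<in>trig_polys E. \<forall>\<xi>\<in>dual_group. P \<xi> = \<xi> (\<theta> n) * (\<Sum>\<gamma>\<in>A n. \<xi> \<gamma>) ^ k"
proof -
  define S where "S j = {sum_list l | l. set l \<subseteq> A n \<and> length l = j}" for j
  have "trig_poly_on_dual (S j) (\<lambda>\<xi>. (\<Sum>\<gamma>\<in>A n. \<xi> \<gamma>) ^ j)" for j
  proof (induction j)
    case 0
    show ?case
      by (rule trig_poly_on_dual_family[of "{0}" id _ _ "\<lambda>_. 1"]) (auto simp: S_def dual_groupD)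
  next
    case (Suc j)
    have "trig_poly_on_dual (A n) (\<lambda>\<xi>. \<Sum>\<gamma>\<in>A n. \<xi> \<gamma>)"
      by (rule trig_poly_on_dual_family[of "A n" id _ _ "\<lambda>_. 1"]) (auto simp: finite_A)
    then show ?case
      unfolding power_Suc
    proof (rule trig_poly_on_dual_mult[OF _ Suc])
      fix a s assume "a \<in> A n" "s \<in> S j"
      then obtain l where "set l \<subseteq> A n" "length l = j" "s = sum_list l" by (auto simp: S_def)
      then show "a + s \<in> S (Suc j)"
        using \<open>a \<in> A n\<close> unfolding S_def by (intro CollectI exI[of _ "a # l"]) auto
    qed
  qed
  moreover have "trig_poly_on_dual {\<theta> n} (\<lambda>\<xi>. \<xi> (\<theta> n))"
    using trig_poly_on_dual_monom[of "\<theta> n" "{\<theta> n}" 1] by simp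
  ultimately have "trig_poly_on_dual E (\<lambda>\<xi>. \<xi> (\<theta> n) * (\<Sum>\<gamma>\<in>A n. \<xi> \<gamma>) ^ k)"
    using assms by (elim trig_poly_on_dual_mult) (auto simp: S_def E_iff intro: sums_in_C)
  then obtain F c where "finite F" "F \<subseteq> E"
    "\<And>\<xi>. \<xi> \<in> dual_group \<Longrightarrow> \<xi> (\<theta> n) * (\<Sum>\<gamma>\<in>A n. \<xi> \<gamma>) ^ k = (\<Sum>\<gamma>\<in>F. c \<gamma> * \<xi> \<gamma>)"
    unfolding trig_poly_on_dual_def by blast
  then show ?thesis
    unfolding trig_polys_def by (intro bexI[of _ "\<lambda>\<xi>. \<Sum>\<gamma>\<in>F. c \<gamma> * \<xi> \<gamma>"]) auto
qed

end

context haar_block_system begin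

lemma Lr_norm_block_power:
  fixes r :: real
  assumes P: "\<And>\<xi>. \<xi> \<in> dual_group \<Longrightarrow> P \<xi> = \<xi> (\<theta> n) * (\<Sum>\<gamma>\<in>A n. \<xi> \<gamma>) ^ k" and k: "0 < k"
  shows "Lr_norm \<mu> r P = (LINT \<xi>|\<mu>. norm (\<Sum>\<gamma>\<in>A n. \<xi> \<gamma>) powr (k * r)) powr (1 / r)"
proof -
  have "norm (P \<xi>) powr r = norm (\<Sum>\<gamma>\<in>A n. \<xi> \<gamma>) powr (k * r)" if \<xi>: "\<xi> \<in> dual_group" for \<xi>
  proof -
    have "norm (P \<xi>) = norm (\<Sum>\<gamma>\<in>A n. \<xi> \<gamma>) ^ k"
      by (simp add: P[OF \<xi>] norm_mult norm_power dual_groupD(1)[OF \<xi>])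
    \<comment> \<open>Positivity of \<open>k\<close> matters where the sum vanishes:
      \<open>0 powr 0\<close> is \<open>0\<close>, but \<open>0 ^ 0\<close> is
      \<open>1\<close>.\<close>
    also have "\<dots> = norm (\<Sum>\<gamma>\<in>A n. \<xi> \<gamma>) powr k"
      using k by (cases "norm (\<Sum>\<gamma>\<in>A n. \<xi> \<gamma>) = 0") (simp_all add: powr_realpow)
    finally show ?thesis by (simp add: powr_powr)
  qed
  then have "(LINT \<xi>|\<mu>. norm (P \<xi>) powr r) = (LINT \<xi>|\<mu>. norm (\<Sum>\<gamma>\<in>A n. \<xi> \<gamma>) powr (k * r))"
    by (intro Bochner_Integration.integral_cong) (auto simp: space_haar)
  then show ?thesis by (simp add: Lr_norm_def)
qed

lemma not_Lambda_E:
  assumes p: "0 < p"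
  shows "\<not> Lambda_set \<mu> p E"
proof
  assume "Lambda_set \<mu> p E"
  then obtain q K where q: "0 < q" "q < p" and K: "0 < K"
    and le: "\<And>P. P \<in> trig_polys E \<Longrightarrow> Lr_norm \<mu> p P \<le> K * Lr_norm \<mu> q P"
    unfolding Lambda_set_def by blast
  \<comment> \<open>This gives \<open>k * q \<ge> 2\<close>, as \<open>moment_upper\<close>
    requires. The exponent stays fixed while \<open>n\<close> grows.\<close>
  define k where "k = nat \<lceil>2 / q\<rceil>"
  have kq: "2 / q \<le> k" unfolding k_def by linarith
  then have kq': "2 \<le> k * q" using q by (simp add: field_simps)
  have k0: "0 < k" using kq q by (cases k) (auto simp: field_simps)
  \<comment> \<open>The factors \<open>2 powr k\<close> and \<open>4 powr (1 / p)\<close> come from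
    \<open>N / 2\<close> and \<open>4 * N\<close> in \<open>moment_lower\<close>.\<close>
  define M where "M = K * 2 powr k * 4 powr (1 / p)"
  have bound: "real (card (A n)) powr (1 / q - 1 / p) \<le> M" if kn: "k \<le> n" for n
  proof -
    define N where "N = real (card (A n))"
    have N: "0 < N" using card_A[of n] by (simp add: N_def)
    obtain P where P: "P \<in> trig_polys E" "\<And>\<xi>. \<xi> \<in> dual_group \<Longrightarrow> P \<xi> = \<xi> (\<theta> n) * (\<Sum>\<gamma>\<in>A n. \<xi> \<gamma>) ^ k"
      using block_power_trig_poly[OF kn] by blast
    have Lr: "Lr_norm \<mu> r P = (LINT \<xi>|\<mu>. norm (\<Sum>\<gamma>\<in>A n. \<xi> \<gamma>) powr (k * r)) powr (1 / r)" for r :: real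
      by (rule Lr_norm_block_power[OF P(2) k0])
    have "((N / 2) powr (k * p) / (4 * N)) powr (1 / p) \<le> Lr_norm \<mu> p P"
      unfolding Lr N_def
      using p k0 N by (intro powr_mono2 moment_lower finite_A A_nonempty doubling) (auto simp: N_def)
    also have "\<dots> \<le> K * Lr_norm \<mu> q P" by (rule le[OF P(1)])
    also have "\<dots> \<le> K * (N powr (k * q - 1)) powr (1 / q)"
      unfolding Lr N_def
      using q K kq' by (intro mult_left_mono powr_mono2 moment_upper finite_A A_nonempty doubling) auto
    finally have *: "((N / 2) powr (k * p) / (4 * N)) powr (1 / p) \<le> K * (N powr (k * q - 1)) powr (1 / q)" .
    have L: "((N / 2) powr (k * p) / (4 * N)) powr (1 / p) = N powr k / 2 powr k / (4 powr (1 / p) * N powr (1 / p))"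
      using p N by (simp add: powr_divide powr_mult powr_powr)
    have R: "(N powr (k * q - 1)) powr (1 / q) = N powr k / N powr (1 / q)"
      using q by (simp add: powr_powr powr_diff[symmetric] field_simps)
    have "N powr k * N powr (1 / q) \<le> N powr k * (M * N powr (1 / p))"
      using * N unfolding L R M_def by (simp add: field_simps)
    then have "N powr (1 / q) \<le> M * N powr (1 / p)"
      using N by simp
    then show ?thesis using N by (simp add: powr_diff N_def field_simps)
  qed
  define e where "e = 1 / q - 1 / p"
  have e: "0 < e" using q by (simp add: e_def field_simps)
  have M: "0 < M" using K by (simp add: M_def)
  \<comment> \<open>Since \<open>card (A n)\<close> exceeds \<open>n\<close>, it is then larger than
    \<open>M powr (1 / e)\<close>, which contradicts \<open>bound\<close>; the maximum with
    \<open>k\<close> secures \<open>k \<le> n\<close>.\<close>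
  define n where "n = max k (nat \<lceil>M powr (1 / e)\<rceil>)"
  have "M powr (1 / e) \<le> n" unfolding n_def by linarith
  also have "real n < card (A n)" using card_A[of n] by simp
  finally have "(M powr (1 / e)) powr e < real (card (A n)) powr e"
    using e by (intro powr_less_mono2) auto
  then have "M < real (card (A n)) powr e"
    using e M by (simp add: powr_powr)
  then show False using bound[of n] by (simp add: n_def e_def)
qed

end

section \<open>Existence of block systems\<close>

definition torsion :: "nat \<Rightarrow> 'a::ab_group_add set" where
  "torsion j = {x. nmul j x = 0}"

text \<open>A nonempty fibre of multiplication by \<open>j\<close> is a coset of the
  \<open>j\<close>-torsion.\<close>

lemma finite_nmul_preimage:
  assumes "finite (torsion j :: 'a::ab_group_add set)" "finite F"
  shows "finite {x::'a. nmul j x \<in> F}"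
proof -
  have "finite {x. nmul j x = y}" for y :: 'a
  proof (cases "\<exists>x0. nmul j x0 = y")
    case True
    then obtain x0 where x0: "nmul j x0 = y" by blast
    have "{x. nmul j x = y} \<subseteq> (+) x0 ` torsion j"
    proof
      fix x assume "x \<in> {x. nmul j x = y}"
      then have "x - x0 \<in> torsion j" by (simp add: torsion_def nmul_diff x0)
      then show "x \<in> (+) x0 ` torsion j" by (intro image_eqI[of _ _ "x - x0"]) auto
    qed
    then show ?thesis using assms(1) finite_surj by blast
  next
    case False
    then have "{x. nmul j x = y} = {}" by blast
    then show ?thesis by simp
  qed
  moreover have "{x. nmul j x \<in> F} = (\<Union>y\<in>F. {x. nmul j x = y})" by blast
  ultimately show ?thesis using assms(2) by simp
qed

lemma exists_multiples_avoid:
  assumes "infinite (X :: 'a::ab_group_add set)" "finite J" "\<And>j. j \<in> J \<Longrightarrow> finite (torsion j :: 'a set)" "finite F"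
  shows "\<exists>x\<in>X. \<forall>j\<in>J. nmul j x \<notin> F"
proof -
  have "finite (\<Union>j\<in>J. {x::'a. nmul j x \<in> F})"
    using assms by (intro finite_UN_I finite_nmul_preimage) auto
  then have "X - (\<Union>j\<in>J. {x. nmul j x \<in> F}) \<noteq> {}"
    using assms(1) by (metis Diff_infinite_finite finite.emptyI)
  then show ?thesis by blast
qed

text \<open>With finite 2-torsion, doubling has finite fibres, so all but finitely many elements
  satisfy the second alternative. Otherwise some element of order at most 2 lies outside
  \<open>H\<close>.\<close>

lemma exists_shift:
  assumes "infinite (UNIV :: 'a::ab_group_add set)" "finite H"
  shows "\<exists>\<theta>::'a. \<theta> \<notin> H \<and> (\<theta> + \<theta> = 0 \<or> \<theta> + \<theta> \<notin> H)"
proof (cases "finite (torsion 2 :: 'a set)")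
  case True
  have "finite ({x::'a. nmul 2 x \<in> H} \<union> H)" using finite_nmul_preimage[OF True assms(2)] assms(2) by simp
  then obtain \<theta> where "\<theta> \<notin> {x::'a. nmul 2 x \<in> H} \<union> H" using assms(1) ex_new_if_finite by blast
  then show ?thesis by (auto simp: numeral_2_eq_2)
next
  case False
  then have "torsion 2 - H \<noteq> {}" using assms(2) by (metis Diff_infinite_finite finite.emptyI)
  then show ?thesis by (auto simp: torsion_def numeral_2_eq_2)
qed

text \<open>These are the requirements of \<open>block_system\<close> on a single block that do not
  involve \<open>\<theta>\<close>, stated for an abstract set \<open>F\<close> of frequencies to be
  avoided.\<close>

definition separated_block :: "nat \<Rightarrow> 'a::ab_group_add set \<Rightarrow> 'a set \<Rightarrow> 'a set \<Rightarrow> 'a set \<Rightarrow> bool" where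
  "separated_block n F A B C \<longleftrightarrow> n < card A \<and> card ((\<lambda>(a, b). a + b) ` (A \<times> A)) \<le> 2 * card A \<and>
    (\<forall>l. set l \<subseteq> A \<longrightarrow> length l \<le> n \<longrightarrow> sum_list l \<in> C) \<and> finite B \<and> B \<noteq> {} \<and> finite C \<and>
    C \<subseteq> difference_set B \<and> (\<Sum>c\<in>C. 1 - diff_count B c / card B) \<le> (1 / 2) ^ n \<and>
    (\<forall>v\<in>difference_set B. v \<in> F \<longrightarrow> v = 0) \<and>
    (\<forall>v\<in>difference_set B. \<forall>c\<in>C. c - v \<in> F \<longrightarrow> c - v = 0)"

text \<open>One subgroup serves as \<open>A\<close>, \<open>B\<close> and \<open>C\<close>: it
  contains all its sums, and it is exactly invariant under its own translations, so
  \<open>diff_count M c\<close> equals \<open>card M\<close> and the invariance defect is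
  zero.\<close>

lemma separated_block_subgroup:
  fixes M :: "'a::ab_group_add set"
  assumes "finite M" "0 \<in> M" and diff: "\<And>x y. x \<in> M \<Longrightarrow> y \<in> M \<Longrightarrow> x - y \<in> M"
    and F: "M \<inter> F \<subseteq> {0}" and card: "n < card M"
  shows "separated_block n F M M M"
proof -
  have add: "x + y \<in> M" if "x \<in> M" "y \<in> M" for x y
    using diff[OF that(1) diff[OF assms(2) that(2)]] by simp
  have sums: "sum_list l \<in> M" if "set l \<subseteq> M" for l
    using that by (induction l) (auto intro: add assms(2))
  have D: "difference_set M = M"
  proof
    show "difference_set M \<subseteq> M" by (auto simp: difference_set_def diff)
    show "M \<subseteq> difference_set M" using difference_set_mem[OF assms(2)] by fastforce
  qed
  have "diff_count M c = card M" if "c \<in> M" for c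
  proof -
    have "{(b, b') \<in> M \<times> M. b' - b = c} = (\<lambda>b. (b, b + c)) ` M"
      using add that by (auto simp: image_iff algebra_simps)
    moreover have "inj_on (\<lambda>b. (b, b + c)) M" by (rule inj_onI) auto
    ultimately show ?thesis by (simp add: diff_count_def card_image)
  qed
  moreover have "0 < card M" using assms(1,2) by (auto simp: card_gt_0_iff)
  ultimately have "(\<Sum>c\<in>M. 1 - diff_count M c / card M) = 0" by (intro sum.neutral) simp
  moreover have "card ((\<lambda>(a, b). a + b) ` (M \<times> M)) \<le> card M"
    using add assms(1) by (intro card_mono) auto
  moreover have "c - v = 0" if "v \<in> M" "c \<in> M" "c - v \<in> F" for c v
    using diff[OF that(2,1)] that(3) F by blast
  ultimately show ?thesis
    unfolding separated_block_def D using assms sums by auto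
qed

text \<open>Minimality of \<open>N\<close> lets a new generator \<open>g\<close> be chosen such that no \<open>j g\<close> with \<open>0 < j < N\<close> meets a
  given finite set.\<close>

lemma exists_subgroup_avoid:
  fixes F :: "'a::ab_group_add set"
  assumes inf: "infinite (torsion N :: 'a set)" and fin: "\<And>j. 0 < j \<Longrightarrow> j < N \<Longrightarrow> finite (torsion j :: 'a set)"
    and N: "0 < N" and F: "finite F"
  shows "\<exists>M. finite M \<and> 0 \<in> M \<and> (\<forall>x\<in>M. \<forall>y\<in>M. x - y \<in> M) \<and> M \<inter> F \<subseteq> {0} \<and> n < card M"
proof (induction n)
  case 0
  show ?case by (intro exI[of _ "{0}"]) auto
next
  case (Suc n)
  then obtain M where M: "finite M" "0 \<in> M" "\<And>x y. x \<in> M \<Longrightarrow> y \<in> M \<Longrightarrow> x - y \<in> M" "M \<inter> F \<subseteq> {0}" "n < card M"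
    by blast
  have "torsion 1 = {0::'a}" by (auto simp: torsion_def)
  then have N1: "1 < N" using inf N by (cases "N = 1") auto
  \<comment> \<open>If \<open>nmul j g\<close> is not in \<open>F'\<close>, the coset of
    \<open>M\<close> through \<open>nmul j g\<close> misses \<open>F\<close>; the extra
    \<open>0\<close> keeps \<open>g\<close> out of \<open>M\<close>, so that the subgroup really
    grows.\<close>
  define F' where "F' = (\<lambda>(f, x). f - x) ` (insert 0 F \<times> M)"
  have "finite F'" using F M(1) by (simp add: F'_def)
  then obtain g where g: "g \<in> torsion N" "\<And>j. 0 < j \<Longrightarrow> j < N \<Longrightarrow> nmul j g \<notin> F'"
    using exists_multiples_avoid[OF inf, of "{0<..<N}" F'] fin by auto
  have mod: "nmul i g = nmul (i mod N) g" for i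
    using nmul_add[of "i div N * N" "i mod N" g] g(1) by (simp add: nmul_mult torsion_def)
  define M' where "M' = (\<lambda>(x, j). x + nmul j g) ` (M \<times> {..<N})"
  have M'I: "x + nmul j g \<in> M'" if "x \<in> M" for x j
    unfolding M'_def mod[of j] using that N by (intro image_eqI[of _ _ "(x, j mod N)"]) auto
  have fin': "finite M'" using M(1) by (simp add: M'_def)
  have sub: "M \<subseteq> M'" using M'I[of _ 0] by auto
  have diff': "x - y \<in> M'" if xy: "x \<in> M'" "y \<in> M'" for x y
  proof -
    obtain a i b j where *: "a \<in> M" "x = a + nmul i g" "b \<in> M" "y = b + nmul j g" "j < N"
      using xy by (auto simp: M'_def)
    have "nmul (N - j) g = - nmul j g"
      using *(5) g(1) by (simp add: nmul_diff_left torsion_def)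
    then have "x - y = (a - b) + nmul (i + (N - j)) g"
      by (simp add: * nmul_add)
    then show ?thesis using M'I[OF M(3)[OF *(1,3)]] by simp
  qed
  have F0: "M' \<inter> F \<subseteq> {0}"
  proof
    fix y assume y: "y \<in> M' \<inter> F"
    then obtain x j where *: "x \<in> M" "j < N" "y = x + nmul j g" by (auto simp: M'_def)
    have "j = 0"
    proof (rule ccontr)
      assume "j \<noteq> 0"
      moreover have "nmul j g \<in> F'"
        unfolding F'_def using y * by (intro image_eqI[of _ _ "(y, x)"]) auto
      ultimately show False using g(2) *(2) by blast
    qed
    then show "y \<in> {0}" using * y M(4) by auto
  qed
  have "g \<notin> M"
  proof
    assume "g \<in> M"
    then have "- g \<in> M" using M(3)[OF M(2), of g] by simp
    then have "nmul 1 g \<in> F'"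
      unfolding F'_def by (intro image_eqI[of _ _ "(0, - g)"]) auto
    then show False using g(2)[of 1] N1 by simp
  qed
  moreover have "g \<in> M'" using M'I[OF M(2), of 1] by simp
  ultimately have "M \<subset> M'" using sub by blast
  then have card': "card M < card M'" using fin' by (rule psubset_card_mono[rotated])
  have "0 \<in> M'" "Suc n < card M'" using sub M(2,5) card' by auto
  then show ?case using fin' diff' F0 by blast
qed

text \<open>Sums of at most \<open>n\<close> terms with indices up to \<open>n\<close> stop at index
  \<open>n\<^sup>2\<close>. A shift by such an index loses at most \<open>n\<^sup>2\<close> of the
  \<open>L\<close> elements of \<open>B\<close>, so the total defect is at most
  \<open>(n\<^sup>2 + 1) * n\<^sup>2 / L\<close>, and \<open>L\<close> is chosen to bring this down
  to \<open>(1 / 2) ^ n\<close>. The differences to be kept out of \<open>F\<close> are differences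
  of multiples with indices at most \<open>R\<close>.\<close>

lemma separated_block_progression:
  fixes \<gamma> :: "'a::ab_group_add"
  assumes L: "L = (n\<^sup>2 + 1) * (n\<^sup>2 + 1) * 2 ^ n" and R: "R = L + n\<^sup>2"
    and \<gamma>: "\<And>j. 0 < j \<Longrightarrow> j \<le> R \<Longrightarrow> nmul j \<gamma> \<notin> F \<and> - nmul j \<gamma> \<notin> F \<and> nmul j \<gamma> \<noteq> 0"
  shows "separated_block n F ((\<lambda>j. nmul j \<gamma>) ` {..n}) ((\<lambda>j. nmul j \<gamma>) ` {..<L}) ((\<lambda>j. nmul j \<gamma>) ` {..n\<^sup>2})"
proof -
  let ?m = "\<lambda>j. nmul j \<gamma>"
  have nL: "n\<^sup>2 < L"
  proof -
    have "n\<^sup>2 + 1 = (n\<^sup>2 + 1) * 1 * 1" by simp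
    also have "\<dots> \<le> L" unfolding L by (intro mult_mono) auto
    finally show ?thesis by simp
  qed
  have nR: "n \<le> R" using nL self_le_power[of n 2] by (cases "n = 0") (auto simp: R)
  have avoid: "?m i - ?m j = 0" if "i \<le> R" "j \<le> R" "?m i - ?m j \<in> F" for i j
  proof (cases i j rule: linorder_cases)
    case less
    then have "?m i - ?m j = - ?m (j - i)" by (simp add: nmul_diff_left)
    then show ?thesis using \<gamma>[of "j - i"] less that by auto
  next
    case greater
    then have "?m i - ?m j = ?m (i - j)" by (simp add: nmul_diff_left)
    then show ?thesis using \<gamma>[of "i - j"] greater that by auto
  qed simp
  have inj: "inj_on ?m {..R}"
  proof (rule linorder_inj_onI)
    fix i j assume ij: "i < j" "i \<in> {..R}" "j \<in> {..R}"
    then have "?m (j - i) \<noteq> 0" using \<gamma>[of "j - i"] by auto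
    then show "?m i \<noteq> ?m j" using ij(1) by (auto simp: nmul_diff_left)
  qed auto
  have card: "card (?m ` X) = card X" if "X \<subseteq> {..R}" for X
    using card_image[OF inj_on_subset[OF inj that]] .
  have cardA: "card (?m ` {..n}) = n + 1" using nR by (subst card) auto
  have cardB: "card (?m ` {..<L}) = L" by (subst card) (auto simp: R)
  have doubling: "card ((\<lambda>(a, b). a + b) ` (?m ` {..n} \<times> ?m ` {..n})) \<le> 2 * card (?m ` {..n})"
  proof -
    have "(\<lambda>(a, b). a + b) ` (?m ` {..n} \<times> ?m ` {..n}) \<subseteq> ?m ` {..2 * n}"
      by (auto simp flip: nmul_add)
    then have "card ((\<lambda>(a, b). a + b) ` (?m ` {..n} \<times> ?m ` {..n})) \<le> card (?m ` {..2 * n})"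
      by (intro card_mono) auto
    also have "\<dots> \<le> card {..2 * n}" by (intro card_image_le) simp
    finally show ?thesis by (simp add: cardA)
  qed
  have sums: "sum_list l \<in> ?m ` {..length l * n}" if "set l \<subseteq> ?m ` {..n}" for l
    using that
  proof (induction l)
    case (Cons a l)
    then obtain i j where ij: "i \<le> n" "a = ?m i" "j \<le> length l * n" "sum_list l = ?m j" by auto
    then have "sum_list (a # l) = ?m (i + j)" by (simp add: nmul_add)
    moreover have "i + j \<le> length (a # l) * n" using ij by simp
    ultimately show ?case by blast
  qed (auto intro: image_eqI[of _ _ 0])
  have sumsC: "sum_list l \<in> ?m ` {..n\<^sup>2}" if "set l \<subseteq> ?m ` {..n}" "length l \<le> n" for l
  proof -
    have "length l * n \<le> n\<^sup>2" unfolding power2_eq_square using that(2) by (rule mult_right_mono) simp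
    then show ?thesis using sums[OF that(1)] by auto
  qed
  have CB: "?m ` {..n\<^sup>2} \<subseteq> difference_set (?m ` {..<L})"
  proof
    fix c assume "c \<in> ?m ` {..n\<^sup>2}"
    then have "c \<in> ?m ` {..<L}" using nL by auto
    moreover have "0 \<in> ?m ` {..<L}" using nL by (intro image_eqI[of _ _ 0]) auto
    ultimately show "c \<in> difference_set (?m ` {..<L})" using difference_set_mem[of 0 _ c] by simp
  qed
  have count: "L - c \<le> diff_count (?m ` {..<L}) (?m c)" if "c \<le> n\<^sup>2" for c
  proof -
    have sub: "(\<lambda>j. (?m j, ?m (j + c))) ` {..<L - c} \<subseteq> {(b, b') \<in> ?m ` {..<L} \<times> ?m ` {..<L}. b' - b = ?m c}"
    proof (rule image_subsetI)
      fix j assume "j \<in> {..<L - c}"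
      then have "?m j \<in> ?m ` {..<L}" "?m (j + c) \<in> ?m ` {..<L}" by auto
      moreover have "?m (j + c) - ?m j = ?m c" by (simp add: nmul_add)
      ultimately show "(?m j, ?m (j + c)) \<in> {(b, b') \<in> ?m ` {..<L} \<times> ?m ` {..<L}. b' - b = ?m c}" by blast
    qed
    have fin: "finite {(b, b') \<in> ?m ` {..<L} \<times> ?m ` {..<L}. b' - b = ?m c}"
      by (rule finite_subset[of _ "?m ` {..<L} \<times> ?m ` {..<L}"]) auto
    have inj': "inj_on (\<lambda>j. (?m j, ?m (j + c))) {..<L - c}"
      using inj by (auto simp: inj_on_def R)
    have "L - c = card ((\<lambda>j. (?m j, ?m (j + c))) ` {..<L - c})"
      using card_image[OF inj'] by simp
    also have "\<dots> \<le> diff_count (?m ` {..<L}) (?m c)"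
      unfolding diff_count_def by (rule card_mono[OF fin sub])
    finally show ?thesis .
  qed
  have inv: "(\<Sum>c\<in>?m ` {..n\<^sup>2}. 1 - diff_count (?m ` {..<L}) c / card (?m ` {..<L})) \<le> (1 / 2) ^ n"
  proof -
    have L0: "0 < real L" using nL by simp
    have "1 - diff_count (?m ` {..<L}) c / L \<le> real (n\<^sup>2) / L" if c: "c \<in> ?m ` {..n\<^sup>2}" for c
    proof -
      obtain i where i: "i \<le> n\<^sup>2" "c = ?m i" using c by auto
      have "real L - n\<^sup>2 \<le> diff_count (?m ` {..<L}) c"
      proof -
        have "L \<le> n\<^sup>2 + diff_count (?m ` {..<L}) c" using count[OF i(1)] i by simp
        then have "real L \<le> real (n\<^sup>2 + diff_count (?m ` {..<L}) c)" by (rule of_nat_mono)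
        then show ?thesis by simp
      qed
      then have "(real L - diff_count (?m ` {..<L}) c) / L \<le> real (n\<^sup>2) / L"
        by (intro divide_right_mono) auto
      then show ?thesis using L0 by (simp add: diff_divide_distrib)
    qed
    then have "(\<Sum>c\<in>?m ` {..n\<^sup>2}. 1 - diff_count (?m ` {..<L}) c / L) \<le> card (?m ` {..n\<^sup>2}) * (real (n\<^sup>2) / L)"
      using sum_bounded_above[of "?m ` {..n\<^sup>2}"] by (metis (no_types, lifting))
    also have "card (?m ` {..n\<^sup>2}) = n\<^sup>2 + 1" using nL by (subst card) (auto simp: R)
    also have "real (n\<^sup>2 + 1) * (real (n\<^sup>2) / L) \<le> real (n\<^sup>2 + 1) * (real (n\<^sup>2 + 1) / L)"
      by (intro mult_left_mono divide_right_mono) auto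
    also have "\<dots> = (1 / 2) ^ n"
    proof -
      have "x * (x / (x * x * 2 ^ n)) = (1 / 2) ^ n" if "x \<noteq> 0" for x :: real
        using that by (simp add: power_one_over)
      moreover have "real L = real (n\<^sup>2 + 1) * real (n\<^sup>2 + 1) * 2 ^ n"
        unfolding L of_nat_mult of_nat_power of_nat_numeral ..
      moreover have "real (n\<^sup>2 + 1) \<noteq> 0" by linarith
      ultimately show ?thesis by (simp only: not_False_eq_True)
    qed
    finally show ?thesis unfolding cardB .
  qed
  have avoid_F: "v = 0" if v: "v \<in> difference_set (?m ` {..<L})" "v \<in> F" for v
    using v avoid by (auto simp: difference_set_def R)
  have avoid_CF: "c - v = 0" if v: "v \<in> difference_set (?m ` {..<L})" "c \<in> ?m ` {..n\<^sup>2}" "c - v \<in> F" for c v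
  proof -
    obtain i j k where ijk: "c = ?m k" "k \<le> n\<^sup>2" "v = ?m i - ?m j" "i < L" "j < L"
      using v by (auto simp: difference_set_def)
    have eq: "c - v = ?m (k + j) - ?m i" by (simp add: ijk nmul_add)
    show ?thesis
      unfolding eq
    proof (rule avoid)
      show "?m (k + j) - ?m i \<in> F" using v(3) unfolding eq .
    qed (use ijk in \<open>auto simp: R\<close>)
  qed
  have "?m ` {..<L} \<noteq> {}" using nL by auto
  then show ?thesis
    unfolding separated_block_def
    by (intro conjI allI impI ballI doubling sumsC CB inv avoid_F avoid_CF finite_imageI) (simp_all add: cardA)
qed

lemma exists_separated_block:
  fixes F :: "'a::ab_group_add set"
  assumes inf: "infinite (UNIV :: 'a set)" and F: "finite F"
  shows "\<exists>A B C. separated_block n F A B C"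
proof (cases "\<exists>N>0. infinite (torsion N :: 'a set)")
  case True
  \<comment> \<open>Minimality makes the \<open>j\<close>-torsion finite for
    \<open>0 < j < N\<close>, as \<open>exists_subgroup_avoid\<close> requires.\<close>
  define N where "N = (LEAST N. N > 0 \<and> infinite (torsion N :: 'a set))"
  have N: "0 < N" "infinite (torsion N :: 'a set)"
    using LeastI_ex[OF True] unfolding N_def by auto
  have fin: "finite (torsion j :: 'a set)" if "0 < j" "j < N" for j
    using not_less_Least[of j "\<lambda>N. N > 0 \<and> infinite (torsion N :: 'a set)"] that unfolding N_def by blast
  have "\<exists>M. finite M \<and> 0 \<in> M \<and> (\<forall>x\<in>M. \<forall>y\<in>M. x - y \<in> M) \<and> M \<inter> F \<subseteq> {0} \<and> n < card M"
    by (rule exists_subgroup_avoid[OF N(2) _ N(1) F]) (rule fin)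
  then obtain M where M: "finite M" "0 \<in> M" "\<forall>x\<in>M. \<forall>y\<in>M. x - y \<in> M" "M \<inter> F \<subseteq> {0}" "n < card M"
    by (elim exE conjE)
  have "separated_block n F M M M"
    by (rule separated_block_subgroup[OF M(1,2) _ M(4,5)]) (use M(3) in blast)
  then show ?thesis by blast
next
  case False
  define L R where "L = (n\<^sup>2 + 1) * (n\<^sup>2 + 1) * 2 ^ n" and "R = L + n\<^sup>2"
  \<comment> \<open>The negatives of \<open>F\<close> are avoided too, because differences of
    multiples occur with both signs.\<close>
  have "\<exists>\<gamma>\<in>UNIV. \<forall>j\<in>{0<..R}. nmul j \<gamma> \<notin> insert 0 (F \<union> uminus ` F)"
  proof (rule exists_multiples_avoid[OF inf])
    fix j assume "j \<in> {0<..R}"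
    then have "0 < j" by simp
    then show "finite (torsion j :: 'a set)" using False by blast
  qed (use F in auto)
  then obtain \<gamma> where \<gamma>: "\<And>j. 0 < j \<Longrightarrow> j \<le> R \<Longrightarrow> nmul j \<gamma> \<notin> insert 0 (F \<union> uminus ` F)"
    by (meson greaterThanAtMost_iff)
  show ?thesis
  proof (intro exI, rule separated_block_progression[OF L_def R_def])
    fix j assume "0 < j" "j \<le> R"
    note * = \<gamma>[OF this]
    have "- nmul j \<gamma> \<notin> F"
    proof
      assume "- nmul j \<gamma> \<in> F"
      then have "- (- nmul j \<gamma>) \<in> uminus ` F" by (rule imageI)
      then show False using * by simp
    qed
    then show "nmul j \<gamma> \<notin> F \<and> - nmul j \<gamma> \<notin> F \<and> nmul j \<gamma> \<noteq> 0" using * by blast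
  qed
qed

text \<open>Avoiding \<open>difference_set T\<close> will give \<open>diff_T\<close>, and avoiding
  \<open>T\<close> itself will give \<open>diff_C\<close>.\<close>

definition block_step :: "nat \<Rightarrow> 'a::ab_group_add set \<Rightarrow> 'a set \<times> 'a set \<times> 'a set \<times> 'a \<Rightarrow> bool" where
  "block_step n T = (\<lambda>(A, B, C, \<theta>). separated_block n (T \<union> difference_set T) A B C \<and>
    (\<forall>s\<in>T. \<forall>v\<in>difference_set B. \<forall>c\<in>C. s + v \<noteq> \<theta> + c) \<and>
    (\<forall>s\<in>T. \<forall>t\<in>T. \<forall>v\<in>difference_set B. s + v + \<theta> \<noteq> t \<and> s + v - \<theta> \<noteq> t) \<and>
    (\<forall>s\<in>T. \<forall>v\<in>difference_set B. \<forall>c\<in>C. s + v - \<theta> = \<theta> + c \<longrightarrow> \<theta> + \<theta> = 0))"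

text \<open>The block is chosen first. Each condition on \<open>\<theta>\<close> then rules out
  finitely many values, gathered in \<open>H\<close>; the doubling condition is met by either
  alternative of \<open>exists_shift\<close>.\<close>

lemma exists_block_step:
  fixes T :: "'a::ab_group_add set"
  assumes inf: "infinite (UNIV :: 'a set)" and T: "finite T"
  shows "\<exists>Z. block_step n T Z"
proof -
  have "finite (T \<union> difference_set T)" using T by (simp add: difference_set_def)
  then obtain A B C where blk: "separated_block n (T \<union> difference_set T) A B C"
    using exists_separated_block[OF inf] by blast
  then have fin: "finite B" "finite C" by (auto simp: separated_block_def)
  let ?D = "difference_set B"
  have finD: "finite ?D" using fin by (simp add: difference_set_def)
  define H where "H = (\<lambda>(s, v, c). s + v - c) ` (T \<times> ?D \<times> C) \<union> (\<lambda>(s, v, t). t - s - v) ` (T \<times> ?D \<times> T)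
      \<union> (\<lambda>(s, v, t). s + v - t) ` (T \<times> ?D \<times> T)"
  have "finite H" using T fin finD by (simp add: H_def)
  then obtain \<theta> where \<theta>: "\<theta> \<notin> H" "\<theta> + \<theta> = 0 \<or> \<theta> + \<theta> \<notin> H"
    using exists_shift[OF inf] by blast
  have H1: "s + v - c \<in> H" if "s \<in> T" "v \<in> ?D" "c \<in> C" for s v c
    unfolding H_def using that by (intro UnI1 image_eqI[of _ _ "(s, v, c)"]) auto
  have H2: "t - s - v \<in> H" if "s \<in> T" "v \<in> ?D" "t \<in> T" for s v t
    unfolding H_def using that by (intro UnI1[OF UnI2] image_eqI[of _ _ "(s, v, t)"]) auto
  have H3: "s + v - t \<in> H" if "s \<in> T" "v \<in> ?D" "t \<in> T" for s v t
    unfolding H_def using that by (intro UnI2 image_eqI[of _ _ "(s, v, t)"]) auto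
  have "s + v \<noteq> \<theta> + c" if "s \<in> T" "v \<in> ?D" "c \<in> C" for s v c
    using H1[OF that] \<theta>(1) by auto
  moreover have "s + v + \<theta> \<noteq> t" if "s \<in> T" "v \<in> ?D" "t \<in> T" for s v t
    using H2[OF that] \<theta>(1) by auto
  moreover have "s + v - \<theta> \<noteq> t" if "s \<in> T" "v \<in> ?D" "t \<in> T" for s v t
    using H3[OF that] \<theta>(1) by auto
  moreover have "\<theta> + \<theta> = 0" if "s \<in> T" "v \<in> ?D" "c \<in> C" "s + v - \<theta> = \<theta> + c" for s v c
  proof -
    have "\<theta> + \<theta> = s + v - c" using that(4) by (simp add: algebra_simps)
    then show ?thesis using H1[OF that(1-3)] \<theta>(2) by simp
  qed
  ultimately show ?thesis
    using blk by (intro exI[of _ "(A, B, C, \<theta>)"]) (auto simp: block_step_def)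
qed

lemma exists_block_system:
  assumes inf: "infinite (UNIV :: 'a::ab_group_add set)"
  shows "\<exists>A B C T (\<theta> :: nat \<Rightarrow> 'a). block_system A B C T \<theta>"
proof -
  define Z where "Z n T = (SOME Z. block_step n (T :: 'a set) Z)" for n T
  have Z: "block_step n T (Z n T)" if "finite T" for n T
    unfolding Z_def by (rule someI_ex[OF exists_block_step[OF inf that]])
  \<comment> \<open>The recursion runs over \<open>T\<close> alone: stage \<open>n\<close> depends
    on the earlier choices only through \<open>T n\<close>, and the new set holds exactly the sums
    that \<open>T_step\<close> asks for.\<close>
  define T where "T = rec_nat {0} (\<lambda>n S. case Z n S of (A, B, C, \<theta>) \<Rightarrow>
    (\<lambda>(s, v, e). s + v + e) ` (S \<times> difference_set B \<times> {0, \<theta>, - \<theta>}))"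
  define A where "A n = fst (Z n (T n))" for n
  define B where "B n = fst (snd (Z n (T n)))" for n
  define C where "C n = fst (snd (snd (Z n (T n))))" for n
  define \<theta> where "\<theta> n = snd (snd (snd (Z n (T n))))" for n
  have ZT: "Z n (T n) = (A n, B n, C n, \<theta> n)" for n by (simp add: A_def B_def C_def \<theta>_def)
  have T0: "T 0 = {0}" by (simp add: T_def)
  have "T (Suc n) = (case Z n (T n) of (A, B, C, \<theta>) \<Rightarrow>
      (\<lambda>(s, v, e). s + v + e) ` (T n \<times> difference_set B \<times> {0, \<theta>, - \<theta>}))" for n
    by (simp add: T_def)
  then have TS: "T (Suc n) = (\<lambda>(s, v, e). s + v + e) ` (T n \<times> difference_set (B n) \<times> {0, \<theta> n, - \<theta> n})" for n
    by (simp only: ZT prod.case)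
  have finT: "finite (T n)" for n
  proof (induction n)
    case (Suc n)
    then have "finite (B n)"
      using Z[OF Suc, of n] by (simp add: ZT block_step_def separated_block_def)
    then show ?case using Suc by (simp add: TS difference_set_def)
  qed (simp add: T0)
  have step: "block_step n (T n) (A n, B n, C n, \<theta> n)" for n
    using Z[OF finT, of n n] by (simp add: ZT)
  then have sep: "separated_block n (T n \<union> difference_set (T n)) (A n) (B n) (C n)" for n
    by (simp add: block_step_def)
  have "block_system A B C T \<theta>"
  proof
    fix n
    show "n < card (A n)" "card ((\<lambda>(a, b). a + b) ` (A n \<times> A n)) \<le> 2 * card (A n)"
      "finite (B n)" "B n \<noteq> {}" "finite (C n)" "C n \<subseteq> difference_set (B n)"
      "(\<Sum>c\<in>C n. 1 - diff_count (B n) c / card (B n)) \<le> (1 / 2) ^ n"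
      using sep[of n] by (simp_all add: separated_block_def)
    show "sum_list l \<in> C n" if "set l \<subseteq> A n" "length l \<le> n" for l
      using sep[of n] that by (simp add: separated_block_def)
    show "finite (T n)" by (rule finT)
    show "0 \<in> T 0" by (simp add: T0)
    fix s assume s: "s \<in> T n"
    fix v assume v: "v \<in> difference_set (B n)"
    show "s + v + e \<in> T (Suc n)" if "e \<in> {0, \<theta> n, - \<theta> n}" for e
      unfolding TS using s v that by (intro image_eqI[of _ _ "(s, v, e)"]) auto
    show "v = 0" if "t \<in> T n" "s + v = t" for t
    proof -
      have "v = t - s" using that(2) by (simp add: algebra_simps)
      then have "v \<in> difference_set (T n)" using difference_set_mem[OF s that(1)] by simp
      then show ?thesis using sep[of n] v by (simp add: separated_block_def)
    qed
    show "s = 0" if "c \<in> C n" "s + v = c" for c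
    proof -
      have "c - v = s" using that(2) by (simp add: algebra_simps)
      then show ?thesis using sep[of n] v that(1) s by (force simp: separated_block_def)
    qed
    show "s + v \<noteq> \<theta> n + c" if "c \<in> C n" for c
      using step[of n] s v that by (auto simp: block_step_def)
    show "s + v + \<theta> n \<noteq> t" "s + v - \<theta> n \<noteq> t" if "t \<in> T n" for t
      using step[of n] s v that by (auto simp: block_step_def)
    show "\<theta> n + \<theta> n = 0" if "c \<in> C n" "s + v - \<theta> n = \<theta> n + c" for c
      using step[of n] s v that unfolding block_step_def prod.case by blast
  qed
  then show ?thesis by blast
qed

theorem corollary8p15:
  assumes "infinite (UNIV :: 'a::ab_group_add set)"
  shows "\<exists>E :: 'a set. \<forall>\<mu>. normalized_haar \<mu> \<longrightarrow>
           rosenthal_set \<mu> E \<and> (\<forall>p>0. \<not> Lambda_set \<mu> p E)"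
proof -
  \<comment> \<open>The system is fixed before \<open>\<mu>\<close>, so one set serves every
    normalized Haar measure.\<close>
  obtain A B C T and \<theta> :: "nat \<Rightarrow> 'a" where sys: "block_system A B C T \<theta>"
    using exists_block_system[OF assms] by blast
  show ?thesis
  proof (intro exI[of _ "block_system.E C \<theta>"] allI impI)
    fix \<mu> :: "('a \<Rightarrow> complex) measure" assume "normalized_haar \<mu>"
    then interpret haar_block_system \<mu> A B C T \<theta>
      using sys by (simp add: haar_block_system_def haar_def)
    show "rosenthal_set \<mu> E \<and> (\<forall>p>0. \<not> Lambda_set \<mu> p E)"
      using rosenthal_E not_Lambda_E by blast
  qed
qed

end
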